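(* Let $n\ge2$. At the critical level $\kappa=\kappa_c$, i.e. $k=-h^\vee$, $$C^{\kappa_c}(\mathfrak{gl}_{n|1})=\mathfrak z(\mathcal W^{\kappa_c}(\mathfrak{gl}_{n|1})).$$
   Context: Levels: $\mathfrak g=\mathfrak{gl}_{n|1}$ with elementary matrices $e_{i,j}$ (indices $\le n$ even, $n+1$ odd), $\kappa_V(u,v)=\operatorname{str}_{\mathbb C^{n|1}}(uv)$, $\kappa_{\mathfrak g}$ the Killing form, $h^\vee=n-1$; for $k\in\mathbb C$, $\kappa=(k+h^\vee)\kappa_V-\frac12\kappa_{\mathfrak g}$, and $\kappa_c=-\frac12\kappa_{\mathfrak g}$. $V^\kappa(\mathfrak g)$ is the universal affine vertex superalgebra: $[u{}_\lambda v]=[u,v]+\kappa(u,v)\lambda$. The center of a vertex superalgebra $V$ is $\mathfrak z(V)=\{a\in V:[Y(a,z),Y(b,w)]=0\ \forall b\in V\}$. Regular $\mathcal W$-superalgebra: let $f=e_{2,1}+\cdots+e_{n,n-1}$ and let $\mathfrak g=\bigoplus_d\mathfrak g_d$ be the $\mathbb Z$-grading with $\deg e_{i,i+1}=1$ ($1\le i\le n-1$), $\deg e_{n,n+1}=0$ (and opposite degrees for transposes). Let $\mathfrak g_+=\bigoplus_{d>0}\mathfrak g_d$ with homogeneous basis $e_\alpha$, $[e_\alpha,e_\beta]=\sum_\gamma c_{\alpha\beta}^\gamma e_\gamma$; let $\bigwedge^\bullet(\mathfrak g_+)$ be the vertex superalgebra generated by $\psi_\alpha,\psi_\alpha^*$,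 of parity opposite to $e_\alpha$, with $[\psi_\alpha{}_\lambda\psi^*_\beta]=\delta_{\alpha\beta}$ and other brackets zero. The BRST complex is $V^\kappa(\mathfrak g)\otimes\bigwedge^\bullet(\mathfrak g_+)$ with $d=Q_{(0)}$, $Q=\sum_\alpha(-1)^{p(e_\alpha)}(e_\alpha+(f|e_\alpha))\psi^*_\alpha-\frac12\sum(-1)^{p(e_\alpha)p(e_\gamma)}c_{\alpha\beta}^\gamma\psi_\gamma\psi^*_\alpha\psi^*_\beta$, $(\cdot|\cdot)=\kappa_V$; $\mathcal W^\kappa(\mathfrak{gl}_{n|1})$ is its $0$-th cohomology. Known free field realization: let $\mathcal A_\psi$ be the vertex superalgebra of odd fields $\psi,\psi^*$ with $[\psi{}_\lambda\psi^*]=1$, $[\psi{}_\lambda\psi]=[\psi^*{}_\lambda\psi^*]=0$, and $x=\psi\psi^*$. Let $\pi_{\mathfrak h}^{k+h^\vee}$ be the Heisenberg vertex algebra generated by $u_1,\dots,u_{n+1}$ ($u_i\leftrightarrow e_{i,i}$), $[u_i{}_\lambda u_j]=(k+h^\vee)\kappa_V(e_{i,i},e_{j,j})\lambda$. There is an embedding $\Psi:\mathcal W^\kappa(\mathfrak{gl}_{n|1})\hookrightarrow\mathcal A_\psi\otimes\pi_{\mathfrak h}^{k+h^\vee}$, continuous in $\kappa$, whose image for generic $\kappa$ is $\bigcap_{i=1}^n\ker S_i$, $S_i=\int Y(P_i\,\mathrm e^{-\frac{1}{k+h^\vee}\alpha_i},z)\,dz$, $P_i=\mathbf 1$ for $i<n$,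 $P_n=\psi$, $\alpha_i=u_i-u_{i+1}$ for $i<n$, $\alpha_n=u_n+u_{n+1}$. Heisenberg coset: under $\Psi$, $\mathcal W^\kappa(\mathfrak{gl}_{n|1})$ contains $J=x-u_{n+1}$ with $[J{}_\lambda J]=(1-(k+h^\vee))\lambda$; $\pi_J$ is the vertex subalgebra it generates and $C^\kappa(\mathfrak{gl}_{n|1})=\operatorname{Com}(\pi_J,\mathcal W^\kappa(\mathfrak{gl}_{n|1}))$, the elements whose fields commute with the fields of $\pi_J$. *)

theory Defs
  imports Complex_Main "HOL-Library.Countable_Set" "HOL-Algebra.Module" "HOL-Algebra.AbelCoset"
begin

section \<open>Vertex superalgebras\<close>

definition complex_ring :: "complex ring" where
  "complex_ring = \<lparr>carrier = UNIV, mult = (*), one = 1, zero = 0, add = (+)\<rparr>"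

text \<open>
  \<open>nprod V a m b\<close> is the product \<open>a\<^sub>(\<^sub>m\<^sub>)b\<close>, where \<open>Y(a,z) = \<Sum>\<^sub>m a\<^sub>(\<^sub>m\<^sub>) z\<^bsup>-m-1\<^esup>\<close>, and \<open>part V False\<close>,
  \<open>part V True\<close> are the even and odd parts.  As for all modules of HOL-Algebra, the fields
  \<open>mult\<close> and \<open>one\<close> inherited from rings carry no meaning.  The translation operator is
  \<open>a \<mapsto> a\<^sub>(\<^sub>-\<^sub>2\<^sub>)|0\<rangle>\<close>.
\<close>

record 'v vsa = "(complex, 'v) module" +
  vac :: 'v
  nprod :: "'v \<Rightarrow> int \<Rightarrow> 'v \<Rightarrow> 'v"
  part :: "bool \<Rightarrow> 'v set"

definition ssign :: "bool \<Rightarrow> bool \<Rightarrow> complex" where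
  "ssign p q = (if p \<and> q then -1 else 1)"

text \<open>
  The last axiom is the Borcherds identity
  \<open>\<Sum>\<^sub>j (m choose j) (a\<^sub>(\<^sub>l\<^sub>+\<^sub>j\<^sub>)b)\<^sub>(\<^sub>m\<^sub>+\<^sub>n\<^sub>-\<^sub>j\<^sub>)c =
   \<Sum>\<^sub>j (-1)\<^sup>j (l choose j) (a\<^sub>(\<^sub>m\<^sub>+\<^sub>l\<^sub>-\<^sub>j\<^sub>)b\<^sub>(\<^sub>n\<^sub>+\<^sub>j\<^sub>)c - (-1)\<^sup>l (-1)\<^bsup>p(a)p(b)\<^esup> b\<^sub>(\<^sub>n\<^sub>+\<^sub>l\<^sub>-\<^sub>j\<^sub>)a\<^sub>(\<^sub>m\<^sub>+\<^sub>j\<^sub>)c)\<close>;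
  by truncation only finitely many terms are nonzero, so both sums agree with all their
  sufficiently long partial sums.
\<close>

locale vertex_superalgebra = module complex_ring V for V :: "'v vsa" (structure) +
  assumes part_submodule: "submodule (part V p) complex_ring V"
    and part_decomp: "a \<in> carrier V \<Longrightarrow>
          \<exists>!(a0, a1). a0 \<in> part V False \<and> a1 \<in> part V True \<and> a = a0 \<oplus> a1"
    and vac_even: "vac V \<in> part V False"
    and nprod_part: "a \<in> part V p \<Longrightarrow> b \<in> part V q \<Longrightarrow> nprod V a m b \<in> part V (p \<noteq> q)"
    and nprod_closed: "a \<in> carrier V \<Longrightarrow> b \<in> carrier V \<Longrightarrow> nprod V a m b \<in> carrier V"
    and nprod_add_left: "a \<in> carrier V \<Longrightarrow> a' \<in> carrier V \<Longrightarrow> b \<in> carrier V \<Longrightarrow>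
          nprod V (a \<oplus> a') m b = nprod V a m b \<oplus> nprod V a' m b"
    and nprod_add_right: "a \<in> carrier V \<Longrightarrow> b \<in> carrier V \<Longrightarrow> b' \<in> carrier V \<Longrightarrow>
          nprod V a m (b \<oplus> b') = nprod V a m b \<oplus> nprod V a m b'"
    and nprod_smult_left: "a \<in> carrier V \<Longrightarrow> b \<in> carrier V \<Longrightarrow>
          nprod V (s \<odot> a) m b = s \<odot> nprod V a m b"
    and nprod_smult_right: "a \<in> carrier V \<Longrightarrow> b \<in> carrier V \<Longrightarrow>
          nprod V a m (s \<odot> b) = s \<odot> nprod V a m b"
    and truncation: "a \<in> carrier V \<Longrightarrow> b \<in> carrier V \<Longrightarrow> \<exists>N. \<forall>m\<ge>N. nprod V a m b = \<zero>"
    and vac_nprod: "a \<in> carrier V \<Longrightarrow> nprod V (vac V) m a = (if m = -1 then a else \<zero>)"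
    and nprod_vac: "a \<in> carrier V \<Longrightarrow> nprod V a (-1) (vac V) = a"
    and nprod_vac_nonneg: "a \<in> carrier V \<Longrightarrow> 0 \<le> m \<Longrightarrow> nprod V a m (vac V) = \<zero>"
    and borcherds: "a \<in> part V p \<Longrightarrow> b \<in> part V q \<Longrightarrow> c \<in> carrier V \<Longrightarrow>
          \<exists>N0. \<forall>N\<ge>N0.
            (\<Oplus>j\<in>{..<N}. (complex_of_int m gchoose j) \<odot>
                nprod V (nprod V a (l + int j) b) (m + n - int j) c)
          = (\<Oplus>j\<in>{..<N::nat}. ((-1) ^ j * (complex_of_int l gchoose j)) \<odot>
                (nprod V a (m + l - int j) (nprod V b (n + int j) c) \<ominus>
                 ((-1) powi l * ssign p q) \<odot> nprod V b (n + l - int j) (nprod V a (m + int j) c)))"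

definition vsa_embedding :: "'v vsa \<Rightarrow> 'w vsa \<Rightarrow> ('v \<Rightarrow> 'w) \<Rightarrow> bool" where
  "vsa_embedding V W \<phi> \<longleftrightarrow>
     \<phi> \<in> carrier V \<rightarrow> carrier W \<and> inj_on \<phi> (carrier V) \<and>
     (\<forall>a\<in>carrier V. \<forall>b\<in>carrier V. \<phi> (a \<oplus>\<^bsub>V\<^esub> b) = \<phi> a \<oplus>\<^bsub>W\<^esub> \<phi> b) \<and>
     (\<forall>s. \<forall>a\<in>carrier V. \<phi> (s \<odot>\<^bsub>V\<^esub> a) = s \<odot>\<^bsub>W\<^esub> \<phi> a) \<and>
     \<phi> (vac V) = vac W \<and>
     (\<forall>m. \<forall>a\<in>carrier V. \<forall>b\<in>carrier V. \<phi> (nprod V a m b) = nprod W (\<phi> a) m (\<phi> b)) \<and>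
     (\<forall>p. \<phi> ` part V p \<subseteq> part W p)"

inductive_set vgen :: "'v vsa \<Rightarrow> 'v set \<Rightarrow> 'v set" for V :: "'v vsa" and S :: "'v set" where
  vac: "vac V \<in> vgen V S"
| incl: "a \<in> S \<Longrightarrow> a \<in> vgen V S"
| add: "a \<in> vgen V S \<Longrightarrow> b \<in> vgen V S \<Longrightarrow> a \<oplus>\<^bsub>V\<^esub> b \<in> vgen V S"
| smult: "a \<in> vgen V S \<Longrightarrow> s \<odot>\<^bsub>V\<^esub> a \<in> vgen V S"
| nprod: "a \<in> vgen V S \<Longrightarrow> b \<in> vgen V S \<Longrightarrow> nprod V a m b \<in> vgen V S"

definition restrict_vsa :: "'v vsa \<Rightarrow> 'v set \<Rightarrow> 'v vsa" where
  "restrict_vsa V A = V\<lparr>carrier := A, part := (\<lambda>p. part V p \<inter> A)\<rparr>"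

definition component :: "'v vsa \<Rightarrow> bool \<Rightarrow> 'v \<Rightarrow> 'v" where
  "component V p a = (THE a'. a' \<in> part V p \<and> (\<exists>a''\<in>part V (\<not> p). a = a' \<oplus>\<^bsub>V\<^esub> a''))"

text \<open>The supercommutator \<open>[a\<^sub>(\<^sub>m\<^sub>), b\<^sub>(\<^sub>n\<^sub>)]c\<close>, extended bilinearly to inhomogeneous \<open>a\<close>, \<open>b\<close>.\<close>

definition mode_bracket :: "'v vsa \<Rightarrow> 'v \<Rightarrow> int \<Rightarrow> 'v \<Rightarrow> int \<Rightarrow> 'v \<Rightarrow> 'v" where
  "mode_bracket V a m b n c = finsum V (\<lambda>(p, q).
     nprod V (component V p a) m (nprod V (component V q b) n c) \<ominus>\<^bsub>V\<^esub>
     ssign p q \<odot>\<^bsub>V\<^esub> nprod V (component V q b) n (nprod V (component V p a) m c)) UNIV"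

definition fields_commute :: "'v vsa \<Rightarrow> 'v \<Rightarrow> 'v \<Rightarrow> bool" where
  "fields_commute V a b \<longleftrightarrow> (\<forall>m n. \<forall>c\<in>carrier V. mode_bracket V a m b n c = \<zero>\<^bsub>V\<^esub>)"

definition commutant :: "'v set \<Rightarrow> 'v vsa \<Rightarrow> 'v set" where
  "commutant S V = {a \<in> carrier V. \<forall>b\<in>S. fields_commute V a b}"

definition vcenter :: "'v vsa \<Rightarrow> 'v set" where
  "vcenter V = {a \<in> carrier V. \<forall>b\<in>carrier V. fields_commute V a b}"

text \<open>\<open>[a\<^sub>\<lambda> b] = r + s \<lambda>\<close>, where \<open>[a\<^sub>\<lambda> b] = \<Sum>\<^sub>j \<lambda>\<^sup>j/j! a\<^sub>(\<^sub>j\<^sub>)b\<close>.\<close>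

definition lambda_bracket :: "'v vsa \<Rightarrow> 'v \<Rightarrow> 'v \<Rightarrow> 'v \<Rightarrow> complex \<Rightarrow> bool" where
  "lambda_bracket V a b r s \<longleftrightarrow>
     nprod V a 0 b = r \<and> nprod V a 1 b = s \<odot>\<^bsub>V\<^esub> vac V \<and> (\<forall>j\<ge>2. nprod V a j b = \<zero>\<^bsub>V\<^esub>)"


section \<open>Bases, free generation and tensor products\<close>

definition expansion :: "'v vsa \<Rightarrow> 'i set \<Rightarrow> ('i \<Rightarrow> 'v) \<Rightarrow> 'v \<Rightarrow> ('i \<Rightarrow> complex) \<Rightarrow> bool" where
  "expansion V I B v c \<longleftrightarrow> finite {i. c i \<noteq> 0} \<and> {i. c i \<noteq> 0} \<subseteq> I \<and>
     v = (\<Oplus>\<^bsub>V\<^esub>i\<in>{i. c i \<noteq> 0}. c i \<odot>\<^bsub>V\<^esub> B i)"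

definition basis_family :: "'v vsa \<Rightarrow> 'i set \<Rightarrow> ('i \<Rightarrow> 'v) \<Rightarrow> bool" where
  "basis_family V I B \<longleftrightarrow> B ` I \<subseteq> carrier V \<and> (\<forall>v\<in>carrier V. \<exists>!c. expansion V I B v c)"

definition coords :: "'v vsa \<Rightarrow> 'i set \<Rightarrow> ('i \<Rightarrow> 'v) \<Rightarrow> 'v \<Rightarrow> 'i \<Rightarrow> complex" where
  "coords V I B v = (THE c. expansion V I B v c)"

text \<open>
  A word over a list \<open>gs\<close> of generators consists of letters \<open>(i, m)\<close> standing for
  \<open>(gs ! i)\<^sub>(\<^sub>-\<^sub>m\<^sub>-\<^sub>1\<^sub>)\<close>; it acts on the vacuum, the first letter being applied last.
  The PBW words are the ordered ones in which only letters of even generators may be repeated.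
\<close>

definition monomial :: "'v vsa \<Rightarrow> 'v list \<Rightarrow> (nat \<times> nat) list \<Rightarrow> 'v" where
  "monomial V gs w = foldr (\<lambda>(i, m) v. nprod V (gs ! i) (- int m - 1) v) w (vac V)"

definition pbw_words :: "'v vsa \<Rightarrow> 'v list \<Rightarrow> (nat \<times> nat) list set" where
  "pbw_words V gs = {w. (\<forall>(i, m)\<in>set w. i < length gs) \<and>
     sorted_wrt (\<lambda>(i, m) (j, l). i < j \<or> i = j \<and> m < l \<or>
                   i = j \<and> m = l \<and> gs ! i \<in> part V False) w}"

definition freely_generated :: "'v vsa \<Rightarrow> 'v list \<Rightarrow> bool" where
  "freely_generated V gs \<longleftrightarrow> basis_family V (pbw_words V gs) (monomial V gs)"

text \<open>
  \<open>V = A \<otimes> B\<close> internally: \<open>A\<close> and \<open>B\<close> are commuting vertex subalgebras and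
  \<open>a \<otimes> b \<mapsto> a\<^sub>(\<^sub>-\<^sub>1\<^sub>)b\<close> is a linear isomorphism from \<open>A \<otimes> B\<close> onto \<open>V\<close>, i.e. it takes the tensor
  product of a basis of \<open>A\<close> and a basis of \<open>B\<close> to a basis of \<open>V\<close>.
\<close>

definition is_tensor_product :: "'v vsa \<Rightarrow> 'v set \<Rightarrow> 'v set \<Rightarrow> bool" where
  "is_tensor_product V A B \<longleftrightarrow>
     vertex_superalgebra V \<and> A \<subseteq> carrier V \<and> B \<subseteq> carrier V \<and>
     vertex_superalgebra (restrict_vsa V A) \<and> vertex_superalgebra (restrict_vsa V B) \<and>
     (\<forall>a\<in>A. \<forall>b\<in>B. fields_commute V a b) \<and>
     (\<exists>S T. basis_family (restrict_vsa V A) S (\<lambda>s. s) \<and> basis_family (restrict_vsa V B) T (\<lambda>t. t) \<and>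
            basis_family V (S \<times> T) (\<lambda>(s, t). nprod V s (-1) t))"


section \<open>The Lie superalgebra \<open>gl(n|1)\<close>\<close>

text \<open>
  An element is given by its matrix entries, with row and column indices in \<open>{1..n+1}\<close>;
  the elementary matrix \<open>elem (i, j)\<close> and its parity and degree are indexed by the pair \<open>(i, j)\<close>.
\<close>

type_synonym cmat = "nat \<Rightarrow> nat \<Rightarrow> complex"

definition gl_indices :: "nat \<Rightarrow> (nat \<times> nat) list" where
  "gl_indices n = [(i, j). i \<leftarrow> [1..<n+2], j \<leftarrow> [1..<n+2]]"

definition elem :: "nat \<times> nat \<Rightarrow> cmat" where
  "elem ij = (\<lambda>a b. if (a, b) = ij then 1 else 0)"

definition podd :: "nat \<Rightarrow> nat \<times> nat \<Rightarrow> bool" where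
  "podd n ij \<longleftrightarrow> (fst ij = n + 1) \<noteq> (snd ij = n + 1)"

definition str :: "nat \<Rightarrow> cmat \<Rightarrow> complex" where
  "str n u = (\<Sum>i = 1..n+1. (if i = n + 1 then -1 else 1) * u i i)"

definition mmult :: "nat \<Rightarrow> cmat \<Rightarrow> cmat \<Rightarrow> cmat" where
  "mmult n u v = (\<lambda>a b. \<Sum>c = 1..n+1. u a c * v c b)"

text \<open>\<open>[u, v] = uv - (-1)\<^bsup>p(u)p(v)\<^esup> vu\<close>, extended bilinearly.\<close>

definition sbracket :: "nat \<Rightarrow> cmat \<Rightarrow> cmat \<Rightarrow> cmat" where
  "sbracket n u v = (\<lambda>a b. \<Sum>c = 1..n+1.
     u a c * v c b - ssign (podd n (c, b)) (podd n (a, c)) * v a c * u c b)"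

definition kappaV :: "nat \<Rightarrow> cmat \<Rightarrow> cmat \<Rightarrow> complex" where
  "kappaV n u v = str n (mmult n u v)"

text \<open>The Killing form is the supertrace of \<open>ad u \<circ> ad v\<close> over the basis of elementary matrices.\<close>

definition killing :: "nat \<Rightarrow> cmat \<Rightarrow> cmat \<Rightarrow> complex" where
  "killing n u v = (\<Sum>\<gamma>\<in>set (gl_indices n). (if podd n \<gamma> then -1 else 1) *
     sbracket n u (sbracket n v (elem \<gamma>)) (fst \<gamma>) (snd \<gamma>))"

definition dual_coxeter :: "nat \<Rightarrow> complex" where
  "dual_coxeter n = of_nat n - 1"

definition kappa :: "nat \<Rightarrow> complex \<Rightarrow> cmat \<Rightarrow> cmat \<Rightarrow> complex" where
  "kappa n k u v = (k + dual_coxeter n) * kappaV n u v - (1/2) * killing n u v"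

text \<open>\<open>min i n\<close> is the position of the \<open>i\<close>-th basis vector of \<open>\<complex>\<^bsup>n|1\<^esup>\<close>: the vectors \<open>n\<close> and \<open>n+1\<close>
  share a position because \<open>deg e\<^bsub>n,n+1\<^esub> = 0\<close>.\<close>

definition gl_degree :: "nat \<Rightarrow> nat \<times> nat \<Rightarrow> int" where
  "gl_degree n ij = int (min (snd ij) n) - int (min (fst ij) n)"

definition gplus :: "nat \<Rightarrow> (nat \<times> nat) list" where
  "gplus n = filter (\<lambda>\<alpha>. 0 < gl_degree n \<alpha>) (gl_indices n)"

definition fnil :: "nat \<Rightarrow> cmat" where
  "fnil n = (\<lambda>a b. \<Sum>i = 1..n-1. elem (i + 1, i) a b)"


section \<open>The BRST complex and the regular W-superalgebra\<close>

definition universal_affine :: "nat \<Rightarrow> complex \<Rightarrow> 'v vsa \<Rightarrow> (nat \<times> nat \<Rightarrow> 'v) \<Rightarrow> bool" where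
  "universal_affine n k V e \<longleftrightarrow>
     vertex_superalgebra V \<and>
     (\<forall>\<alpha>\<in>set (gl_indices n). e \<alpha> \<in> part V (podd n \<alpha>)) \<and>
     (\<forall>\<alpha>\<in>set (gl_indices n). \<forall>\<beta>\<in>set (gl_indices n).
        lambda_bracket V (e \<alpha>) (e \<beta>)
          (\<Oplus>\<^bsub>V\<^esub>\<gamma>\<in>set (gl_indices n). sbracket n (elem \<alpha>) (elem \<beta>) (fst \<gamma>) (snd \<gamma>) \<odot>\<^bsub>V\<^esub> e \<gamma>)
          (kappa n k (elem \<alpha>) (elem \<beta>))) \<and>
     freely_generated V (map e (gl_indices n))"

definition ghost_vsa :: "nat \<Rightarrow> 'v vsa \<Rightarrow> (nat \<times> nat \<Rightarrow> 'v) \<Rightarrow> (nat \<times> nat \<Rightarrow> 'v) \<Rightarrow> bool" where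
  "ghost_vsa n V g gs \<longleftrightarrow>
     vertex_superalgebra V \<and>
     (\<forall>\<alpha>\<in>set (gplus n). g \<alpha> \<in> part V (\<not> podd n \<alpha>) \<and> gs \<alpha> \<in> part V (\<not> podd n \<alpha>)) \<and>
     (\<forall>\<alpha>\<in>set (gplus n). \<forall>\<beta>\<in>set (gplus n).
        lambda_bracket V (g \<alpha>) (gs \<beta>) (if \<alpha> = \<beta> then vac V else \<zero>\<^bsub>V\<^esub>) 0 \<and>
        lambda_bracket V (g \<alpha>) (g \<beta>) \<zero>\<^bsub>V\<^esub> 0 \<and>
        lambda_bracket V (gs \<alpha>) (gs \<beta>) \<zero>\<^bsub>V\<^esub> 0) \<and>
     freely_generated V (map g (gplus n) @ map gs (gplus n))"

definition complex_gens ::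
  "nat \<Rightarrow> (nat \<times> nat \<Rightarrow> 'v) \<Rightarrow> (nat \<times> nat \<Rightarrow> 'v) \<Rightarrow> (nat \<times> nat \<Rightarrow> 'v) \<Rightarrow> 'v list" where
  "complex_gens n e g gs = map e (gl_indices n) @ map g (gplus n) @ map gs (gplus n)"

definition brst_complex ::
  "nat \<Rightarrow> complex \<Rightarrow> 'v vsa \<Rightarrow> (nat \<times> nat \<Rightarrow> 'v) \<Rightarrow> (nat \<times> nat \<Rightarrow> 'v) \<Rightarrow> (nat \<times> nat \<Rightarrow> 'v) \<Rightarrow> bool"
  where
  "brst_complex n k C e g gs \<longleftrightarrow>
     (\<exists>A B. is_tensor_product C A B \<and>
            universal_affine n k (restrict_vsa C A) e \<and> ghost_vsa n (restrict_vsa C B) g gs)"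

definition brst_Q ::
  "nat \<Rightarrow> 'v vsa \<Rightarrow> (nat \<times> nat \<Rightarrow> 'v) \<Rightarrow> (nat \<times> nat \<Rightarrow> 'v) \<Rightarrow> (nat \<times> nat \<Rightarrow> 'v) \<Rightarrow> 'v" where
  "brst_Q n C e g gs =
     (\<Oplus>\<^bsub>C\<^esub>\<alpha>\<in>set (gplus n). (if podd n \<alpha> then -1 else 1) \<odot>\<^bsub>C\<^esub>
        nprod C (e \<alpha> \<oplus>\<^bsub>C\<^esub> kappaV n (fnil n) (elem \<alpha>) \<odot>\<^bsub>C\<^esub> vac C) (-1) (gs \<alpha>))
     \<ominus>\<^bsub>C\<^esub> (1/2) \<odot>\<^bsub>C\<^esub>
     finsum C (\<lambda>(\<alpha>, \<beta>, \<gamma>).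
        (ssign (podd n \<alpha>) (podd n \<gamma>) * sbracket n (elem \<alpha>) (elem \<beta>) (fst \<gamma>) (snd \<gamma>)) \<odot>\<^bsub>C\<^esub>
        nprod C (g \<gamma>) (-1) (nprod C (gs \<alpha>) (-1) (gs \<beta>)))
       (set (gplus n) \<times> set (gplus n) \<times> set (gplus n))"

text \<open>The cohomological degree: \<open>gs\<close> has degree \<open>1\<close>, \<open>g\<close> has degree \<open>-1\<close> and \<open>e\<close> has degree \<open>0\<close>.\<close>

inductive brst_degree ::
  "nat \<Rightarrow> 'v vsa \<Rightarrow> (nat \<times> nat \<Rightarrow> 'v) \<Rightarrow> (nat \<times> nat \<Rightarrow> 'v) \<Rightarrow> (nat \<times> nat \<Rightarrow> 'v) \<Rightarrow> int \<Rightarrow> 'v \<Rightarrow> bool"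
  for n C e g gs where
  zero: "brst_degree n C e g gs d \<zero>\<^bsub>C\<^esub>"
| vac: "brst_degree n C e g gs 0 (vac C)"
| e: "\<alpha> \<in> set (gl_indices n) \<Longrightarrow> brst_degree n C e g gs 0 (e \<alpha>)"
| g: "\<alpha> \<in> set (gplus n) \<Longrightarrow> brst_degree n C e g gs (-1) (g \<alpha>)"
| gs: "\<alpha> \<in> set (gplus n) \<Longrightarrow> brst_degree n C e g gs 1 (gs \<alpha>)"
| add: "brst_degree n C e g gs d a \<Longrightarrow> brst_degree n C e g gs d b \<Longrightarrow>
        brst_degree n C e g gs d (a \<oplus>\<^bsub>C\<^esub> b)"
| smult: "brst_degree n C e g gs d a \<Longrightarrow> brst_degree n C e g gs d (s \<odot>\<^bsub>C\<^esub> a)"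
| nprod: "brst_degree n C e g gs d a \<Longrightarrow> brst_degree n C e g gs d' b \<Longrightarrow>
          brst_degree n C e g gs (d + d') (nprod C a m b)"

definition cocycles ::
  "nat \<Rightarrow> 'v vsa \<Rightarrow> (nat \<times> nat \<Rightarrow> 'v) \<Rightarrow> (nat \<times> nat \<Rightarrow> 'v) \<Rightarrow> (nat \<times> nat \<Rightarrow> 'v) \<Rightarrow> 'v set" where
  "cocycles n C e g gs =
     {a. brst_degree n C e g gs 0 a \<and> nprod C (brst_Q n C e g gs) 0 a = \<zero>\<^bsub>C\<^esub>}"

text \<open>Since \<open>Q\<^sub>(\<^sub>0\<^sub>)\<close> squares to zero, the intersection with the cocycles is the whole image.\<close>

definition coboundaries ::
  "nat \<Rightarrow> 'v vsa \<Rightarrow> (nat \<times> nat \<Rightarrow> 'v) \<Rightarrow> (nat \<times> nat \<Rightarrow> 'v) \<Rightarrow> (nat \<times> nat \<Rightarrow> 'v) \<Rightarrow> 'v set" where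
  "coboundaries n C e g gs =
     nprod C (brst_Q n C e g gs) 0 ` {b. brst_degree n C e g gs (-1) b} \<inter> cocycles n C e g gs"

definition quotient_vsa :: "'v vsa \<Rightarrow> 'v set \<Rightarrow> 'v set \<Rightarrow> 'v set vsa" where
  "quotient_vsa V Z B =
     \<lparr>carrier = (\<lambda>a. B +>\<^bsub>V\<^esub> a) ` Z,
      mult = undefined, one = undefined,
      zero = B,
      add = (\<lambda>X Y. X <+>\<^bsub>V\<^esub> Y),
      smult = (\<lambda>s X. \<Union>a\<in>X. B +>\<^bsub>V\<^esub> (s \<odot>\<^bsub>V\<^esub> a)),
      vac = B +>\<^bsub>V\<^esub> vac V,
      nprod = (\<lambda>X m Y. \<Union>a\<in>X. \<Union>b\<in>Y. B +>\<^bsub>V\<^esub> nprod V a m b),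
      part = (\<lambda>p. (\<lambda>a. B +>\<^bsub>V\<^esub> a) ` (Z \<inter> part V p))\<rparr>"

definition W_algebra ::
  "nat \<Rightarrow> 'v vsa \<Rightarrow> (nat \<times> nat \<Rightarrow> 'v) \<Rightarrow> (nat \<times> nat \<Rightarrow> 'v) \<Rightarrow> (nat \<times> nat \<Rightarrow> 'v) \<Rightarrow> 'v set vsa" where
  "W_algebra n C e g gs = quotient_vsa C (cocycles n C e g gs) (coboundaries n C e g gs)"


section \<open>Free fields and screening operators\<close>

definition fermion_vsa :: "'v vsa \<Rightarrow> 'v \<Rightarrow> 'v \<Rightarrow> bool" where
  "fermion_vsa V psi psis \<longleftrightarrow>
     vertex_superalgebra V \<and> psi \<in> part V True \<and> psis \<in> part V True \<and>
     lambda_bracket V psi psis (vac V) 0 \<and>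
     lambda_bracket V psi psi \<zero>\<^bsub>V\<^esub> 0 \<and> lambda_bracket V psis psis \<zero>\<^bsub>V\<^esub> 0 \<and>
     freely_generated V [psi, psis]"

definition heisenberg_vsa :: "nat \<Rightarrow> complex \<Rightarrow> 'v vsa \<Rightarrow> (nat \<Rightarrow> 'v) \<Rightarrow> bool" where
  "heisenberg_vsa n k V u \<longleftrightarrow>
     vertex_superalgebra V \<and> (\<forall>i\<in>{1..n+1}. u i \<in> part V False) \<and>
     (\<forall>i\<in>{1..n+1}. \<forall>j\<in>{1..n+1}. lambda_bracket V (u i) (u j) \<zero>\<^bsub>V\<^esub>
        ((k + dual_coxeter n) * kappaV n (elem (i, i)) (elem (j, j)))) \<and>
     freely_generated V (map u [1..<n+2])"

definition free_field_gens :: "nat \<Rightarrow> 'v \<Rightarrow> 'v \<Rightarrow> (nat \<Rightarrow> 'v) \<Rightarrow> 'v list" where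
  "free_field_gens n psi psis u = [psi, psis] @ map u [1..<n+2]"

definition free_field_vsa ::
  "nat \<Rightarrow> complex \<Rightarrow> 'v vsa \<Rightarrow> 'v \<Rightarrow> 'v \<Rightarrow> (nat \<Rightarrow> 'v) \<Rightarrow> bool" where
  "free_field_vsa n k F psi psis u \<longleftrightarrow>
     (\<exists>A H. is_tensor_product F A H \<and>
            fermion_vsa (restrict_vsa F A) psi psis \<and> heisenberg_vsa n k (restrict_vsa F H) u)"

text \<open>
  For \<open>\<mu>\<close> in the span of the \<open>u\<^sub>i\<close>, the coefficient of \<open>z\<^sup>r\<close> in \<open>exp (\<Sum>\<^bsub>m>0\<^esub> \<mu>\<^sub>(\<^sub>-\<^sub>m\<^sub>) z\<^sup>m / m)\<close> and that of
  \<open>z\<^bsup>-s\<^esup>\<close> in \<open>exp (- \<Sum>\<^bsub>m>0\<^esub> \<mu>\<^sub>(\<^sub>m\<^sub>) z\<^bsup>-m\<^esup> / m)\<close>, computed by differentiating the exponentials.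
\<close>

fun vexp_minus :: "'v vsa \<Rightarrow> 'v \<Rightarrow> nat \<Rightarrow> 'v \<Rightarrow> 'v" where
  "vexp_minus V \<mu> 0 v = v"
| "vexp_minus V \<mu> (Suc r) v = (1 / of_nat (Suc r)) \<odot>\<^bsub>V\<^esub>
     (\<Oplus>\<^bsub>V\<^esub>m\<in>{..r}. nprod V \<mu> (- int (Suc m)) (vexp_minus V \<mu> (r - m) v))"

fun vexp_plus :: "'v vsa \<Rightarrow> 'v \<Rightarrow> nat \<Rightarrow> 'v \<Rightarrow> 'v" where
  "vexp_plus V \<mu> 0 v = v"
| "vexp_plus V \<mu> (Suc s) v = (- 1 / of_nat (Suc s)) \<odot>\<^bsub>V\<^esub>
     (\<Oplus>\<^bsub>V\<^esub>m\<in>{..s}. nprod V \<mu> (int (Suc m)) (vexp_plus V \<mu> (s - m) v))"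

text \<open>
  The residue \<open>\<integral> Y(P e\<^sup>\<mu>, z) dz\<close> on the vacuum Fock space, where
  \<open>Y(P e\<^sup>\<mu>, z) = Y(P, z) exp (\<Sum>\<^bsub>m>0\<^esub> \<mu>\<^sub>(\<^sub>-\<^sub>m\<^sub>) z\<^sup>m / m) exp (- \<Sum>\<^bsub>m>0\<^esub> \<mu>\<^sub>(\<^sub>m\<^sub>) z\<^bsup>-m\<^esup> / m) e\<^sup>\<mu> z\<^bsup>\<mu>(0)\<^esup>\<close>: the factor
  \<open>z\<^bsup>\<mu>(0)\<^esup>\<close> is trivial there, and the target Fock space of momentum \<open>\<mu>\<close> is identified with the vacuum one
  through the shift \<open>e\<^sup>\<mu>\<close>, which does not affect the kernel.  Only finitely many summands are nonzero.
\<close>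

definition screening_summand :: "'v vsa \<Rightarrow> 'v \<Rightarrow> 'v \<Rightarrow> 'v \<Rightarrow> nat \<times> nat \<Rightarrow> 'v" where
  "screening_summand F P \<mu> v rs =
     vexp_minus F \<mu> (fst rs) (vexp_plus F \<mu> (snd rs) (nprod F P (int (fst rs) - int (snd rs)) v))"

definition screening :: "'v vsa \<Rightarrow> 'v \<Rightarrow> 'v \<Rightarrow> 'v \<Rightarrow> 'v" where
  "screening F P \<mu> v =
     (\<Oplus>\<^bsub>F\<^esub>rs\<in>{rs. screening_summand F P \<mu> v rs \<noteq> \<zero>\<^bsub>F\<^esub>}. screening_summand F P \<mu> v rs)"

definition simple_root :: "nat \<Rightarrow> 'v vsa \<Rightarrow> (nat \<Rightarrow> 'v) \<Rightarrow> nat \<Rightarrow> 'v" where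
  "simple_root n F u i = (if i < n then u i \<ominus>\<^bsub>F\<^esub> u (i + 1) else u n \<oplus>\<^bsub>F\<^esub> u (n + 1))"

definition screening_kernel ::
  "nat \<Rightarrow> complex \<Rightarrow> 'v vsa \<Rightarrow> 'v \<Rightarrow> (nat \<Rightarrow> 'v) \<Rightarrow> nat \<Rightarrow> 'v set" where
  "screening_kernel n k F psi u i =
     {v \<in> carrier F. screening F (if i < n then vac F else psi)
        ((- 1 / (k + dual_coxeter n)) \<odot>\<^bsub>F\<^esub> simple_root n F u i) v = \<zero>\<^bsub>F\<^esub>}"

definition heis_current :: "nat \<Rightarrow> 'v vsa \<Rightarrow> 'v \<Rightarrow> 'v \<Rightarrow> (nat \<Rightarrow> 'v) \<Rightarrow> 'v" where
  "heis_current n F psi psis u = nprod F psi (-1) psis \<ominus>\<^bsub>F\<^esub> u (n + 1)"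


section \<open>The free field realization and the Heisenberg coset\<close>

text \<open>
  The complexes for different levels \<open>k\<close> have the same PBW words, and so do the free field
  algebras; continuity in \<open>k\<close> refers to coordinates with respect to these bases.  \<open>\<Psi>\<close> is continuous if it
  sends the classes of a continuous family of cocycles, lying in the span of finitely many
  PBW monomials, to a continuous family.
\<close>

definition continuous_in_level ::
  "nat \<Rightarrow> (complex \<Rightarrow> 'c vsa) \<Rightarrow> (complex \<Rightarrow> nat \<times> nat \<Rightarrow> 'c) \<Rightarrow> (complex \<Rightarrow> nat \<times> nat \<Rightarrow> 'c) \<Rightarrow>
   (complex \<Rightarrow> nat \<times> nat \<Rightarrow> 'c) \<Rightarrow> (complex \<Rightarrow> 'f vsa) \<Rightarrow> (complex \<Rightarrow> 'f) \<Rightarrow> (complex \<Rightarrow> 'f) \<Rightarrow>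
   (complex \<Rightarrow> nat \<Rightarrow> 'f) \<Rightarrow> (complex \<Rightarrow> 'c set \<Rightarrow> 'f) \<Rightarrow> bool" where
  "continuous_in_level n C e g gs F psi psis u \<Psi> \<longleftrightarrow>
     (let coordC = (\<lambda>k. let G = complex_gens n (e k) (g k) (gs k)
                        in coords (C k) (pbw_words (C k) G) (monomial (C k) G));
          coordF = (\<lambda>k. let G = free_field_gens n (psi k) (psis k) (u k)
                        in coords (F k) (pbw_words (F k) G) (monomial (F k) G));
          cls = (\<lambda>k a. coboundaries n (C k) (e k) (g k) (gs k) +>\<^bsub>C k\<^esub> a)
      in \<forall>a X. (\<forall>k. a k \<in> cocycles n (C k) (e k) (g k) (gs k)) \<longrightarrow>
           finite X \<longrightarrow> (\<forall>k w. w \<notin> X \<longrightarrow> coordC k (a k) w = 0) \<longrightarrow>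
           (\<forall>w. continuous_on UNIV (\<lambda>k. coordC k (a k) w)) \<longrightarrow>
           (\<forall>w. continuous_on UNIV (\<lambda>k. coordF k (\<Psi> k (cls k (a k))) w)))"

text \<open>
  The family of embeddings \<open>\<Psi>\<close>, with generic meaning: for all but countably many levels.
\<close>

definition free_field_realization ::
  "nat \<Rightarrow> (complex \<Rightarrow> 'c vsa) \<Rightarrow> (complex \<Rightarrow> nat \<times> nat \<Rightarrow> 'c) \<Rightarrow> (complex \<Rightarrow> nat \<times> nat \<Rightarrow> 'c) \<Rightarrow>
   (complex \<Rightarrow> nat \<times> nat \<Rightarrow> 'c) \<Rightarrow> (complex \<Rightarrow> 'f vsa) \<Rightarrow> (complex \<Rightarrow> 'f) \<Rightarrow> (complex \<Rightarrow> 'f) \<Rightarrow>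
   (complex \<Rightarrow> nat \<Rightarrow> 'f) \<Rightarrow> (complex \<Rightarrow> 'c set \<Rightarrow> 'f) \<Rightarrow> bool" where
  "free_field_realization n C e g gs F psi psis u \<Psi> \<longleftrightarrow>
     (\<forall>k. vsa_embedding (W_algebra n (C k) (e k) (g k) (gs k)) (F k) (\<Psi> k)) \<and>
     continuous_in_level n C e g gs F psi psis u \<Psi> \<and>
     (\<exists>K. countable K \<and> (\<forall>k. k \<notin> K \<longrightarrow>
        \<Psi> k ` carrier (W_algebra n (C k) (e k) (g k) (gs k)) =
        (\<Inter>i\<in>{1..n}. screening_kernel n k (F k) (psi k) (u k) i))) \<and>
     (\<forall>k. heis_current n (F k) (psi k) (psis k) (u k) \<in>
        \<Psi> k ` carrier (W_algebra n (C k) (e k) (g k) (gs k)))"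

definition heisenberg_coset :: "'w vsa \<Rightarrow> 'w \<Rightarrow> 'w set" where
  "heisenberg_coset W J = commutant (vgen W {J}) W"

end

theory Submission
  imports Defs
begin

text \<open>
  Write \<open>F\<close> for the free field algebra at the critical level, \<open>A\<close> for its fermionic factor and \<open>H\<close>
  for its Heisenberg factor, so \<open>F = A \<otimes> H\<close>.  At \<open>k + h\<^sup>\<or> = 0\<close> every bracket of the \<open>u\<^sub>i\<close> vanishes, hence
  \<open>H\<close> is central in \<open>F\<close> (\<open>central_generators\<close>), and commuting with \<open>J = x - u\<^bsub>n+1\<^esub>\<close> is the same as
  commuting with \<open>x = \<psi>\<^sub>(\<^sub>-\<^sub>1\<^sub>)\<psi>\<^sup>*\<close>.

  The key point is that only the multiples of the vacuum commute with \<open>x\<close> inside \<open>A\<close>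
  (\<open>fermion_kernel\<close>).  The reason is the boson-fermion correspondence: up to a factor \<open>1/2\<close> the
  Sugawara vector \<open>D = x\<^sub>(\<^sub>-\<^sub>1\<^sub>)x\<close> is the conformal vector of the fermions, so that \<open>D\<^sub>(\<^sub>1\<^sub>)\<close> acts on a PBW
  monomial with letters \<open>(i, m)\<close> as the scalar \<open>\<Sum>(2m + 1)\<close> (\<open>sugawara_shift\<close>), which vanishes on the
  vacuum only; but \<open>D\<^sub>(\<^sub>1\<^sub>)\<close> is a sum of products \<open>x\<^sub>(\<^sub>r\<^sub>)x\<^sub>(\<^sub>s\<^sub>)\<close> with \<open>s \<ge> 0\<close>, so it kills whatever commutes
  with \<open>x\<close>.  Since \<open>x\<close> acts on \<open>A \<otimes> H\<close> through the first factor, the commutant of \<open>x\<close> in \<open>F\<close> is \<open>H\<close>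
  (\<open>tensor_product_fermion_kernel\<close>).

  So an element of the Heisenberg coset is sent by the embedding \<open>\<Psi>\<close> into the center of \<open>F\<close>, and, \<open>\<Psi>\<close>
  being injective, it is central in the W-algebra.  Conversely, central elements commute with the
  vertex subalgebra generated by \<open>J\<close>, provided it lies in the W-algebra, i.e. the W-algebra is closed
  under its operations.  It is, because \<open>Q\<close> is odd and \<open>Q\<^sub>(\<^sub>0\<^sub>)\<close> therefore is an odd derivation of all products:
  cocycles form a subalgebra and coboundaries an ideal of it.
\<close>

section \<open>Consequences of the Borcherds identity\<close>

lemma complex_ring_simps [simp]:
  "carrier complex_ring = UNIV" "\<one>\<^bsub>complex_ring\<^esub> = 1" "\<zero>\<^bsub>complex_ring\<^esub> = 0"
  "s \<oplus>\<^bsub>complex_ring\<^esub> t = s + t" "s \<otimes>\<^bsub>complex_ring\<^esub> t = s * t"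
  by (simp_all add: complex_ring_def)

lemma gchoose_0 [simp]: "(0::complex) gchoose j = (if j = 0 then 1 else 0)"
  by (cases j) auto

lemma gchoose_eq_0_if_less: "m < j \<Longrightarrow> complex_of_int (int m) gchoose j = 0"
  by (metis binomial_eq_0 binomial_gbinomial of_int_of_nat_eq of_nat_0)

lemma minus_1_power_mult_gchoose_minus_2:
  "(-1) ^ j * ((-2 :: complex) gchoose j) = of_nat (Suc j)"
proof -
  have "(-2 :: complex) gchoose j = (-1) ^ j * ((of_nat (Suc j) :: complex) gchoose j)"
    by (subst gbinomial_negated_upper) simp
  also have "(of_nat (Suc j) :: complex) gchoose j = of_nat (Suc j)"
    by (metis binomial_gbinomial binomial_Suc_n)
  finally show ?thesis by (simp flip: power_mult_distrib mult.assoc)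
qed

lemma (in abelian_group) finsum_zeroI: "(\<And>i. i \<in> I \<Longrightarrow> f i = \<zero>) \<Longrightarrow> finsum G f I = \<zero>"
  by (rule add.finprod_one_eqI)

lemma (in abelian_group) finsum_in_subgroup:
  assumes "subgroup H (add_monoid G)" "\<And>i. i \<in> I \<Longrightarrow> f i \<in> H"
  shows "finsum G f I \<in> H"
proof (cases "finite I")
  case True
  have H: "H \<subseteq> carrier G" "\<zero> \<in> H" "\<And>x y. x \<in> H \<Longrightarrow> y \<in> H \<Longrightarrow> x \<oplus> y \<in> H"
    using subgroup.subset[OF assms(1)] subgroup.one_closed[OF assms(1)]
      subgroup.m_closed[OF assms(1)] by auto
  show ?thesis using True assms(2)
  proof (induction I)
    case (insert i I)
    have "f \<in> I \<rightarrow> carrier G" "f i \<in> carrier G" using insert.prems H(1) by auto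
    then show ?case using insert H by simp
  qed (simp add: H)
next
  case False
  then show ?thesis using subgroup.one_closed[OF assms(1)] by (simp add: finsum_infinite)
qed

lemma additive_finsum:
  assumes "abelian_group M" "abelian_group N"
    and closed: "\<And>a. a \<in> carrier M \<Longrightarrow> f a \<in> carrier N"
    and add: "\<And>a b. a \<in> carrier M \<Longrightarrow> b \<in> carrier M \<Longrightarrow> f (a \<oplus>\<^bsub>M\<^esub> b) = f a \<oplus>\<^bsub>N\<^esub> f b"
    and "v \<in> I \<rightarrow> carrier M"
  shows "f (finsum M v I) = finsum N (\<lambda>i. f (v i)) I"
proof -
  interpret M: abelian_group M by fact
  interpret N: abelian_group N by fact
  interpret abelian_group_hom M N f
    using closed add by (intro abelian_group_homI M.abelian_group_axioms N.abelian_group_axioms)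
      (auto simp: group_hom_def group_hom_axioms_def hom_def M.a_group N.a_group)
  show ?thesis
  proof (cases "finite I")
    case True
    then show ?thesis using \<open>v \<in> I \<rightarrow> carrier M\<close> by (induction I) (auto simp: Pi_def)
  qed (simp add: M.finsum_infinite N.finsum_infinite)
qed

context vertex_superalgebra
begin

lemma part_carrier: "a \<in> part V p \<Longrightarrow> a \<in> carrier V"
  using submoduleE(1)[OF part_submodule] by auto

lemma part_zero [simp]: "\<zero> \<in> part V p"
  using submodule.axioms(1)[OF part_submodule] subgroup.one_closed by fastforce

lemma part_add: "a \<in> part V p \<Longrightarrow> b \<in> part V p \<Longrightarrow> a \<oplus> b \<in> part V p"
  using submoduleE(5)[OF part_submodule] by auto

lemma part_smult: "a \<in> part V p \<Longrightarrow> s \<odot> a \<in> part V p"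
  using submoduleE(4)[OF part_submodule] by auto

lemma part_minus: "a \<in> part V p \<Longrightarrow> b \<in> part V p \<Longrightarrow> a \<ominus> b \<in> part V p"
  using submoduleE(3,5)[OF part_submodule] by (simp add: a_minus_def)

lemma part_finsum: "(\<And>i. i \<in> I \<Longrightarrow> f i \<in> part V p) \<Longrightarrow> finsum V f I \<in> part V p"
  by (rule finsum_in_subgroup) (use submodule.axioms(1)[OF part_submodule] in auto)

lemma vac_carrier [simp]: "vac V \<in> carrier V"
  using vac_even part_carrier by blast

declare nprod_closed [simp]

lemma minus_eq_zero_iff:
  "a \<in> carrier V \<Longrightarrow> b \<in> carrier V \<Longrightarrow> a \<ominus> b = \<zero> \<longleftrightarrow> a = b"
  by (simp add: a_minus_def M.minus_equality[symmetric] M.add.inv_solve_right')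

lemma smult_minus_1: "a \<in> carrier V \<Longrightarrow> (-1) \<odot> a = \<ominus> a"
proof -
  assume a: "a \<in> carrier V"
  have "(-1) \<odot> a \<oplus> a = (-1 + 1) \<odot> a"
    using smult_l_distr[of "-1" 1 a] a smult_one[OF a] by simp
  also have "\<dots> = \<zero>" using smult_l_null[OF a] by simp
  finally show ?thesis using a by (intro M.minus_equality[symmetric]) auto
qed

lemma smult_0 [simp]: "a \<in> carrier V \<Longrightarrow> 0 \<odot> a = \<zero>"
  using smult_l_null[of a] by simp

lemma smult_1 [simp]: "a \<in> carrier V \<Longrightarrow> 1 \<odot> a = a"
  using smult_one[of a] by simp

lemma minus_zero_right [simp]: "a \<in> carrier V \<Longrightarrow> a \<ominus> \<zero> = a"
  by (simp add: a_minus_def)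

lemma smult_smult: "a \<in> carrier V \<Longrightarrow> s \<odot> (t \<odot> a) = (s * t) \<odot> a"
  using smult_assoc1[of s t a] by simp

lemma smult_add_left: "a \<in> carrier V \<Longrightarrow> (s + t) \<odot> a = s \<odot> a \<oplus> t \<odot> a"
  using smult_l_distr[of s t a] by simp

lemma smult_add_right:
  "a \<in> carrier V \<Longrightarrow> b \<in> carrier V \<Longrightarrow> s \<odot> (a \<oplus> b) = s \<odot> a \<oplus> s \<odot> b"
  using smult_r_distr[of s a b] by simp

lemma minus_conv_smult: "a \<in> carrier V \<Longrightarrow> b \<in> carrier V \<Longrightarrow> a \<ominus> b = a \<oplus> (-1) \<odot> b"
  by (simp add: a_minus_def smult_minus_1)

lemma smult_eq_zero:
  assumes "a \<in> carrier V" "s \<odot> a = \<zero>" "s \<noteq> 0" shows "a = \<zero>"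
  using smult_smult[OF assms(1), of "1 / s" s] assms by simp

lemma nprod_zero_right [simp]: "a \<in> carrier V \<Longrightarrow> nprod V a m \<zero> = \<zero>"
  using nprod_smult_right[of a \<zero> m 0] by simp

lemma nprod_zero_left [simp]: "a \<in> carrier V \<Longrightarrow> nprod V \<zero> m a = \<zero>"
  using nprod_smult_left[of \<zero> a 0 m] by simp

lemma nprod_finsum_right:
  "a \<in> carrier V \<Longrightarrow> v \<in> I \<rightarrow> carrier V \<Longrightarrow>
     nprod V a m (finsum V v I) = (\<Oplus>i\<in>I. nprod V a m (v i))"
  by (rule additive_finsum) (auto simp: nprod_add_right M.abelian_group_axioms)

lemma nprod_finsum_left:
  "a \<in> carrier V \<Longrightarrow> v \<in> I \<rightarrow> carrier V \<Longrightarrow>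
     nprod V (finsum V v I) m a = (\<Oplus>i\<in>I. nprod V (v i) m a)"
  by (rule additive_finsum[where f = "\<lambda>x. nprod V x m a"])
    (auto simp: nprod_add_left M.abelian_group_axioms)

lemma part_decompE:
  assumes "a \<in> carrier V"
  obtains a0 a1 where "a0 \<in> part V False" "a1 \<in> part V True" "a = a0 \<oplus> a1"
  using part_decomp[OF assms] by blast

lemma part_unique:
  assumes "a0 \<in> part V False" "a1 \<in> part V True" "b0 \<in> part V False" "b1 \<in> part V True"
    and "a0 \<oplus> a1 = b0 \<oplus> b1"
  shows "a0 = b0 \<and> a1 = b1"
proof -
  have "a0 \<oplus> a1 \<in> carrier V" using assms part_carrier by simp
  from part_decomp[OF this] obtain x where x: "\<forall>y. (case y of (c0, c1) \<Rightarrow>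
      c0 \<in> part V False \<and> c1 \<in> part V True \<and> a0 \<oplus> a1 = c0 \<oplus> c1) \<longrightarrow> y = x"
    by (rule ex1E) (rule that)
  show ?thesis using x[rule_format, of "(a0, a1)"] x[rule_format, of "(b0, b1)"] assms by simp
qed

lemma component_eq:
  assumes "a0 \<in> part V False" "a1 \<in> part V True"
  shows "component V p (a0 \<oplus> a1) = (if p then a1 else a0)"
proof (cases p)
  case True
  show ?thesis unfolding component_def
  proof (rule the_equality)
    show "(if p then a1 else a0) \<in> part V p \<and>
        (\<exists>a''\<in>part V (\<not> p). a0 \<oplus> a1 = (if p then a1 else a0) \<oplus> a'')"
      using assms True by (auto intro!: bexI[of _ a0] simp: part_carrier M.a_comm)
  next
    fix a' assume "a' \<in> part V p \<and> (\<exists>a''\<in>part V (\<not> p). a0 \<oplus> a1 = a' \<oplus> a'')"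
    then obtain a'' where "a' \<in> part V True" "a'' \<in> part V False" "a0 \<oplus> a1 = a'' \<oplus> a'"
      using True by (auto simp: part_carrier M.a_comm)
    then show "a' = (if p then a1 else a0)" using part_unique[of a0 a1 a'' a'] assms True by auto
  qed
next
  case False
  show ?thesis unfolding component_def
  proof (rule the_equality)
    show "(if p then a1 else a0) \<in> part V p \<and>
        (\<exists>a''\<in>part V (\<not> p). a0 \<oplus> a1 = (if p then a1 else a0) \<oplus> a'')"
      using assms False by auto
  next
    fix a' assume "a' \<in> part V p \<and> (\<exists>a''\<in>part V (\<not> p). a0 \<oplus> a1 = a' \<oplus> a'')"
    then show "a' = (if p then a1 else a0)" using part_unique[of a0 a1 a'] assms False by auto
  qed
qed

lemma component_homogeneous:
  assumes "a \<in> part V q"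
  shows "component V p a = (if p = q then a else \<zero>)"
proof (cases q)
  case True
  then show ?thesis using component_eq[of \<zero> a p] assms part_carrier by simp
next
  case False
  then show ?thesis using component_eq[of a \<zero> p] assms part_carrier by simp
qed

lemma finsum_lessThan_single:
  assumes "f \<in> UNIV \<rightarrow> carrier V" "\<And>j. j \<noteq> i \<Longrightarrow> f j = \<zero>" "i < N"
  shows "finsum V f {..<N::nat} = f i"
proof -
  have "finsum V f {..<N} = (\<Oplus>j\<in>{..<N}. if i = j then f j else \<zero>)"
    using assms by (intro M.finsum_cong') (auto simp: Pi_def)
  also have "\<dots> = f i" using assms by (intro M.finsum_singleton) auto
  finally show ?thesis .
qed

text \<open>
  The Borcherds identity with \<open>l = 0\<close>, where on the right-hand side only \<open>j = 0\<close> survives.  The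
  existential bound stands for the upper end of a sum with finitely many nonzero terms.
\<close>

lemma commutator_formula:
  assumes "a \<in> part V p" "b \<in> part V q" "c \<in> carrier V"
  shows "\<exists>N0. \<forall>N\<ge>N0.
    nprod V a m (nprod V b n c) \<ominus> ssign p q \<odot> nprod V b n (nprod V a m c) =
    (\<Oplus>j\<in>{..<N}. (complex_of_int m gchoose j) \<odot> nprod V (nprod V a (int j) b) (m + n - int j) c)"
proof -
  have car: "a \<in> carrier V" "b \<in> carrier V" using assms part_carrier by auto
  obtain N0 where N0: "\<forall>N\<ge>N0.
            (\<Oplus>j\<in>{..<N}. (complex_of_int m gchoose j) \<odot>
                nprod V (nprod V a (0 + int j) b) (m + n - int j) c)
          = (\<Oplus>j\<in>{..<N::nat}. ((-1) ^ j * (complex_of_int 0 gchoose j)) \<odot>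
                (nprod V a (m + 0 - int j) (nprod V b (n + int j) c) \<ominus>
                 ((-1) powi 0 * ssign p q) \<odot> nprod V b (n + 0 - int j) (nprod V a (m + int j) c)))"
    using borcherds[OF assms, of m 0 n] by blast
  have "(\<Oplus>j\<in>{..<N}. (complex_of_int m gchoose j) \<odot> nprod V (nprod V a (int j) b) (m + n - int j) c)
      = nprod V a m (nprod V b n c) \<ominus> ssign p q \<odot> nprod V b n (nprod V a m c)"
    if "N \<ge> max 1 N0" for N
  proof -
    have "(\<Oplus>j\<in>{..<N}. (complex_of_int m gchoose j) \<odot> nprod V (nprod V a (int j) b) (m + n - int j) c)
      = (\<Oplus>j\<in>{..<N::nat}. ((-1) ^ j * (complex_of_int 0 gchoose j)) \<odot>
                (nprod V a (m + 0 - int j) (nprod V b (n + int j) c) \<ominus>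
                 ((-1) powi 0 * ssign p q) \<odot> nprod V b (n + 0 - int j) (nprod V a (m + int j) c)))"
      using N0 that by simp
    also have "\<dots> = ((-1) ^ 0 * (complex_of_int 0 gchoose 0)) \<odot>
                (nprod V a (m + 0 - int 0) (nprod V b (n + int 0) c) \<ominus>
                 ((-1) powi 0 * ssign p q) \<odot> nprod V b (n + 0 - int 0) (nprod V a (m + int 0) c))"
      using car assms(3) that by (intro finsum_lessThan_single) auto
    finally show ?thesis using car assms(3) by simp
  qed
  then show ?thesis by (intro exI[of _ "max 1 N0"]) simp
qed

lemma commutator_two_terms:
  assumes "a \<in> part V p" "b \<in> part V q" "c \<in> carrier V"
    and "\<And>j. j \<ge> 2 \<Longrightarrow> nprod V a j b = \<zero>"
  shows "nprod V a m (nprod V b n c) \<ominus> ssign p q \<odot> nprod V b n (nprod V a m c) =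
    nprod V (nprod V a 0 b) (m + n) c \<oplus> of_int m \<odot> nprod V (nprod V a 1 b) (m + n - 1) c"
proof -
  have car: "a \<in> carrier V" "b \<in> carrier V" using assms part_carrier by auto
  let ?f = "\<lambda>j. (complex_of_int m gchoose j) \<odot> nprod V (nprod V a (int j) b) (m + n - int j) c"
  have f: "?f \<in> UNIV \<rightarrow> carrier V" using car assms(3) by auto
  obtain N0 where N0: "\<forall>N\<ge>N0.
    nprod V a m (nprod V b n c) \<ominus> ssign p q \<odot> nprod V b n (nprod V a m c) = finsum V ?f {..<N}"
    using commutator_formula[OF assms(1-3), of m n] by blast
  have "finsum V ?f {..<N0 + 2} = finsum V ?f {0, 1}"
    using f car assms(3,4) by (intro M.add.finprod_mono_neutral_cong_right) auto
  also have "\<dots> = ?f 0 \<oplus> ?f 1" using f car assms(3) by simp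
  finally show ?thesis using N0[rule_format, of "N0 + 2"] car assms(3) by simp
qed

lemma zero_mode_derivation:
  assumes a: "a \<in> part V p" and b: "b \<in> part V q" and c: "c \<in> carrier V"
  shows "nprod V a 0 (nprod V b n c) =
    nprod V (nprod V a 0 b) n c \<oplus> ssign p q \<odot> nprod V b n (nprod V a 0 c)"
proof -
  have car: "a \<in> carrier V" "b \<in> carrier V" using a b part_carrier by auto
  let ?f = "\<lambda>j. (complex_of_int 0 gchoose j) \<odot> nprod V (nprod V a (int j) b) (0 + n - int j) c"
  obtain N0 where N0: "\<forall>N\<ge>N0. nprod V a 0 (nprod V b n c) \<ominus>
      ssign p q \<odot> nprod V b n (nprod V a 0 c) = finsum V ?f {..<N}"
    using commutator_formula[OF a b c, of 0 n] by blast
  have "finsum V ?f {..<Suc N0} = ?f 0"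
    using car c by (intro finsum_lessThan_single) auto
  then have "nprod V a 0 (nprod V b n c) \<ominus> ssign p q \<odot> nprod V b n (nprod V a 0 c)
      = nprod V (nprod V a 0 b) n c"
    using N0[rule_format, of "Suc N0"] car c by simp
  moreover have "nprod V a 0 (nprod V b n c) =
      (nprod V a 0 (nprod V b n c) \<ominus> ssign p q \<odot> nprod V b n (nprod V a 0 c))
        \<oplus> ssign p q \<odot> nprod V b n (nprod V a 0 c)"
    using car c by (simp add: a_minus_def M.a_assoc M.l_neg)
  ultimately show ?thesis by simp
qed

lemma commute_if_nprods_vanish:
  assumes "a \<in> part V p" "b \<in> part V q" "c \<in> carrier V"
    and "\<And>j. j \<ge> 0 \<Longrightarrow> nprod V a j b = \<zero>"
  shows "nprod V a m (nprod V b n c) = ssign p q \<odot> nprod V b n (nprod V a m c)"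
proof -
  have car: "a \<in> carrier V" "b \<in> carrier V" using assms part_carrier by auto
  have "nprod V a m (nprod V b n c) \<ominus> ssign p q \<odot> nprod V b n (nprod V a m c) = \<zero>"
    using commutator_two_terms[OF assms(1-3), of m n] assms(3,4) by simp
  then show ?thesis using minus_eq_zero_iff car assms(3) by simp
qed

text \<open>The Borcherds identity with \<open>m = 0\<close>, where on the left-hand side only \<open>j = 0\<close> survives.\<close>

lemma associativity_formula:
  assumes "a \<in> part V p" "b \<in> part V q" "c \<in> carrier V"
  shows "\<exists>N0. \<forall>N\<ge>N0. nprod V (nprod V a l b) n c =
    (\<Oplus>j\<in>{..<N::nat}. ((-1) ^ j * (complex_of_int l gchoose j)) \<odot>
                (nprod V a (l - int j) (nprod V b (n + int j) c) \<ominus>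
                 ((-1) powi l * ssign p q) \<odot> nprod V b (n + l - int j) (nprod V a (int j) c)))"
proof -
  have car: "a \<in> carrier V" "b \<in> carrier V" using assms part_carrier by auto
  obtain N0 where N0: "\<forall>N\<ge>N0.
            (\<Oplus>j\<in>{..<N}. (complex_of_int 0 gchoose j) \<odot>
                nprod V (nprod V a (l + int j) b) (0 + n - int j) c)
          = (\<Oplus>j\<in>{..<N::nat}. ((-1) ^ j * (complex_of_int l gchoose j)) \<odot>
                (nprod V a (0 + l - int j) (nprod V b (n + int j) c) \<ominus>
                 ((-1) powi l * ssign p q) \<odot> nprod V b (n + l - int j) (nprod V a (0 + int j) c)))"
    using borcherds[OF assms, of 0 l n] by blast
  have "(\<Oplus>j\<in>{..<N}. (complex_of_int 0 gchoose j) \<odot>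
                nprod V (nprod V a (l + int j) b) (0 + n - int j) c) =
      (complex_of_int 0 gchoose 0) \<odot> nprod V (nprod V a (l + int 0) b) (0 + n - int 0) c"
    if "N \<ge> 1" for N
    using car assms(3) that by (intro finsum_lessThan_single) auto
  then have *: "nprod V (nprod V a l b) n c = (\<Oplus>j\<in>{..<N}. (complex_of_int 0 gchoose j) \<odot>
                nprod V (nprod V a (l + int j) b) (0 + n - int j) c)" if "N \<ge> 1" for N
    using car assms(3) that by simp
  show ?thesis
  proof (intro exI allI impI)
    fix N assume "max 1 N0 \<le> N"
    then have "1 \<le> N" "N0 \<le> N" by auto
    from trans[OF *[OF this(1)] N0[rule_format, OF this(2)]]
    show "nprod V (nprod V a l b) n c =
      (\<Oplus>j\<in>{..<N::nat}. ((-1) ^ j * (complex_of_int l gchoose j)) \<odot>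
                (nprod V a (l - int j) (nprod V b (n + int j) c) \<ominus>
                 ((-1) powi l * ssign p q) \<odot> nprod V b (n + l - int j) (nprod V a (int j) c)))"
      by (simp only: add_0_left)
  qed
qed

lemma nprod_nprod_eq_zero:
  assumes "a \<in> part V p" "b \<in> part V q" "c \<in> carrier V"
    and "\<And>j. nprod V a (l - int j) (nprod V b (n + int j) c) = \<zero>"
    and "\<And>j. nprod V b (n + l - int j) (nprod V a (int j) c) = \<zero>"
  shows "nprod V (nprod V a l b) n c = \<zero>"
proof -
  obtain N0 where N0: "\<forall>N\<ge>N0. nprod V (nprod V a l b) n c =
    (\<Oplus>j\<in>{..<N::nat}. ((-1) ^ j * (complex_of_int l gchoose j)) \<odot>
                (nprod V a (l - int j) (nprod V b (n + int j) c) \<ominus>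
                 ((-1) powi l * ssign p q) \<odot> nprod V b (n + l - int j) (nprod V a (int j) c)))"
    using associativity_formula[OF assms(1-3)] by blast
  then show ?thesis
    using N0[rule_format, of N0] by (simp add: assms(4,5) M.finsum_zeroI)
qed

text \<open>
  The rule \<open>(Ta)\<^sub>(\<^sub>-\<^sub>m\<^sub>) = m a\<^sub>(\<^sub>-\<^sub>m\<^sub>-\<^sub>1\<^sub>)\<close> for the translation operator \<open>T\<close>: in the associativity formula
  for \<open>a\<^sub>(\<^sub>-\<^sub>2\<^sub>)|0\<rangle>\<close> the modes of the vacuum single out the term \<open>j = m - 1\<close>.
\<close>

lemma translate_nprod:
  assumes "a \<in> part V p" "c \<in> carrier V"
  shows "nprod V (nprod V a (-2) (vac V)) (- int m) c = of_nat m \<odot> nprod V a (- int m - 1) c"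
proof -
  have car: "a \<in> carrier V" using assms part_carrier by auto
  let ?f = "\<lambda>j. ((-1) ^ j * (complex_of_int (-2) gchoose j)) \<odot>
                (nprod V a (-2 - int j) (nprod V (vac V) (- int m + int j) c) \<ominus>
                 ((-1) powi -2 * ssign p False) \<odot>
                   nprod V (vac V) (- int m + -2 - int j) (nprod V a (int j) c))"
  obtain N0 where N0: "\<forall>N\<ge>N0. nprod V (nprod V a (-2) (vac V)) (- int m) c = finsum V ?f {..<N}"
    using associativity_formula[OF assms(1) vac_even assms(2)] by blast
  have f: "?f j = of_nat (Suc j) \<odot> (if m = Suc j then nprod V a (-2 - int j) c else \<zero>)" for j
    using car assms(2)
    by (auto simp: minus_1_power_mult_gchoose_minus_2 vac_nprod simp del: of_nat_Suc)
  show ?thesis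
  proof (cases m)
    case 0
    then show ?thesis using N0[rule_format, of N0] f car assms(2)
      by (simp add: M.finsum_zeroI del: of_nat_Suc)
  next
    case (Suc i)
    have "finsum V ?f {..<N0 + Suc i} = ?f i"
    proof (rule finsum_lessThan_single)
      show "?f \<in> UNIV \<rightarrow> carrier V" using car assms(2) by simp
      show "?f j = \<zero>" if "j \<noteq> i" for j
        unfolding f using that Suc by simp
    qed simp
    also have "\<dots> = of_nat m \<odot> nprod V a (- int m - 1) c"
    proof -
      have "-2 - int i = - int m - 1" using Suc by simp
      then show ?thesis unfolding f by (simp only: Suc if_True refl)
    qed
    finally show ?thesis using N0[rule_format, of "N0 + Suc i"] by simp
  qed
qed

section \<open>Linear bases\<close>

lemma basis_family_carrier: "basis_family V I B \<Longrightarrow> i \<in> I \<Longrightarrow> B i \<in> carrier V"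
  by (auto simp: basis_family_def)

lemma basis_family_span:
  assumes "basis_family V I B" "v \<in> carrier V"
  obtains I0 c where "finite I0" "I0 \<subseteq> I" "v = (\<Oplus>i\<in>I0. c i \<odot> B i)"
  using assms unfolding basis_family_def expansion_def by blast

lemma basis_family_independent:
  assumes B: "basis_family V I B" and I0: "finite I0" "I0 \<subseteq> I"
    and zero: "(\<Oplus>i\<in>I0. c i \<odot> B i) = \<zero>" and i: "i \<in> I0"
  shows "c i = 0"
proof -
  define c' where "c' = (\<lambda>i. if i \<in> I0 then c i else 0)"
  have supp: "{i. c' i \<noteq> 0} \<subseteq> I0" by (auto simp: c'_def)
  have car: "B i \<in> carrier V" if "i \<in> I0" for i
    using basis_family_carrier[OF B] that I0 by auto
  have "(\<Oplus>i\<in>{i. c' i \<noteq> 0}. c' i \<odot> B i) = (\<Oplus>i\<in>I0. c i \<odot> B i)"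
    using supp I0 car by (intro M.add.finprod_mono_neutral_cong_left) (auto simp: c'_def)
  then have "expansion V I B \<zero> c'"
    using zero supp I0 finite_subset[OF supp I0(1)] by (auto simp: expansion_def)
  moreover have "expansion V I B \<zero> (\<lambda>_. 0)" by (simp add: expansion_def)
  moreover have "\<exists>!c. expansion V I B \<zero> c" using B by (simp add: basis_family_def)
  ultimately have "c' = (\<lambda>_. 0)" by blast
  then show ?thesis using i by (metis c'_def)
qed

section \<open>The current \<open>x = \<psi>\<psi>\<^sup>*\<close> and the energy of fermions\<close>

text \<open>
  The hypotheses say that \<open>\<phi>\<close> is a primary field of charge \<open>-\<epsilon>\<close> for the current \<open>x\<close>; \<open>\<psi>\<close> and \<open>\<psi>\<^sup>*\<close> satisfy
  them with \<open>\<epsilon> = -1\<close> and \<open>\<epsilon> = 1\<close>.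
\<close>

lemma commute_with_charged:
  assumes phi: "\<phi> \<in> part V p" and x: "x \<in> part V False"
    and bracket: "nprod V \<phi> 0 x = \<epsilon> \<odot> \<phi>" "\<And>j. j \<ge> 1 \<Longrightarrow> nprod V \<phi> j x = \<zero>"
    and c: "c \<in> carrier V"
  shows "nprod V \<phi> n (nprod V x m c) =
    nprod V x m (nprod V \<phi> n c) \<oplus> \<epsilon> \<odot> nprod V \<phi> (n + m) c"
proof -
  have car: "\<phi> \<in> carrier V" "x \<in> carrier V" using phi x part_carrier by auto
  have "nprod V \<phi> n (nprod V x m c) \<ominus> nprod V x m (nprod V \<phi> n c) = \<epsilon> \<odot> nprod V \<phi> (n + m) c"
    using commutator_two_terms[OF phi x c, of n m] bracket car c
    by (simp add: ssign_def nprod_smult_left)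
  moreover have "nprod V \<phi> n (nprod V x m c) = nprod V x m (nprod V \<phi> n c) \<oplus>
      (nprod V \<phi> n (nprod V x m c) \<ominus> nprod V x m (nprod V \<phi> n c))"
    using car c by (simp add: a_minus_def M.add.m_lcomm M.r_neg)
  ultimately show ?thesis by simp
qed

text \<open>
  For a charged field with \<open>\<phi>\<^sub>(\<^sub>-\<^sub>1\<^sub>)x = 0\<close> the product \<open>x\<^sub>(\<^sub>-\<^sub>1\<^sub>)\<phi>\<close> is \<open>-\<epsilon> T\<phi>\<close>, so the bracket of \<open>\<phi>\<close> with the
  quadratic vector \<open>D = x\<^sub>(\<^sub>-\<^sub>1\<^sub>)x\<close> involves only \<open>T\<phi>\<close> and \<open>\<phi>\<close>: the currents drop out, and \<open>\<phi>\<^sub>(\<^sub>-\<^sub>m\<^sub>-\<^sub>1\<^sub>)\<close>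
  raises the eigenvalue of \<open>D\<^sub>(\<^sub>1\<^sub>)\<close> by \<open>2m + 1\<close>, twice its conformal weight \<open>m + 1/2\<close>.
\<close>

lemma sugawara_shift:
  assumes phi: "\<phi> \<in> part V p" and x: "x \<in> part V False"
    and bracket: "nprod V \<phi> 0 x = \<epsilon> \<odot> \<phi>" "\<And>j. j \<ge> 1 \<Longrightarrow> nprod V \<phi> j x = \<zero>"
    and normal: "nprod V \<phi> (-1) x = \<zero>" and unit: "\<epsilon> * \<epsilon> = 1"
    and c: "c \<in> carrier V"
  defines "D \<equiv> nprod V x (-1) x"
  shows "nprod V D 1 (nprod V \<phi> (- int m - 1) c) =
    nprod V \<phi> (- int m - 1) (nprod V D 1 c) \<oplus> of_nat (2 * m + 1) \<odot> nprod V \<phi> (- int m - 1) c"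
proof -
  have car: "\<phi> \<in> carrier V" "x \<in> carrier V" using phi x part_carrier by auto
  have D: "D \<in> part V False" using nprod_part[OF x x] by (simp add: D_def)
  then have Dcar: "D \<in> carrier V" by (rule part_carrier)
  note swap = commute_with_charged[OF phi x bracket]
  \<comment> \<open>\<open>swap\<close> on the vacuum, where \<open>\<phi>\<^sub>(\<^sub>-\<^sub>1\<^sub>)x\<^sub>(\<^sub>-\<^sub>1\<^sub>)|0\<rangle> = \<phi>\<^sub>(\<^sub>-\<^sub>1\<^sub>)x = 0\<close>\<close>
  have "nprod V x (-1) \<phi> \<oplus> \<epsilon> \<odot> nprod V \<phi> (-2) (vac V) = \<zero>"
    using swap[of "vac V" "-1" "-1"] normal car by (simp add: nprod_vac)
  then have "\<epsilon> \<odot> (nprod V x (-1) \<phi> \<oplus> \<epsilon> \<odot> nprod V \<phi> (-2) (vac V)) = \<zero>"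
    using smult_r_null by simp
  then have *: "\<epsilon> \<odot> nprod V x (-1) \<phi> \<oplus> nprod V \<phi> (-2) (vac V) = \<zero>"
    using car unit by (simp add: smult_add_right smult_smult)
  have D0: "nprod V \<phi> 0 D = (-1) \<odot> nprod V \<phi> (-2) (vac V)"
    using swap[of x 0 "-1"] normal bracket(1) car M.minus_equality[OF *]
    by (simp add: D_def nprod_smult_right smult_minus_1)
  have D1: "nprod V \<phi> 1 D = \<phi>"
    using swap[of x 1 "-1"] bracket car unit by (simp add: D_def smult_smult)
  have D2: "nprod V \<phi> j D = \<zero>" if "j \<ge> 2" for j
    using swap[of x j "-1"] bracket(2) car that by (simp add: D_def)
  let ?y = "nprod V \<phi> (- int m - 1) c"
  have y: "?y \<in> carrier V" using car c by simp
  have "nprod V \<phi> (- int m - 1) (nprod V D 1 c) \<ominus> nprod V D 1 ?y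
      = nprod V (nprod V \<phi> 0 D) (- int m) c \<oplus> of_int (- int m - 1) \<odot> ?y"
    using commutator_two_terms[OF phi D c D2, of "- int m - 1" 1] car Dcar c D1
    by (simp add: ssign_def)
  also have "nprod V (nprod V \<phi> 0 D) (- int m) c = (- of_nat m) \<odot> ?y"
    using translate_nprod[OF phi c, of m] car c by (simp add: D0 nprod_smult_left smult_smult)
  also have "(- of_nat m) \<odot> ?y \<oplus> of_int (- int m - 1) \<odot> ?y = (- of_nat (2 * m + 1)) \<odot> ?y"
  proof -
    have "(- of_nat m) + of_int (- int m - 1) = (- of_nat (2 * m + 1) :: complex)" by simp
    then show ?thesis using smult_add_left[OF y] by metis
  qed
  finally have "nprod V \<phi> (- int m - 1) (nprod V D 1 c) \<ominus> nprod V D 1 ?y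
      = (- of_nat (2 * m + 1)) \<odot> ?y" .
  then have "nprod V \<phi> (- int m - 1) (nprod V D 1 c) \<ominus> nprod V D 1 ?y \<oplus> (nprod V D 1 ?y \<oplus>
       of_nat (2 * m + 1) \<odot> ?y)
      = (- of_nat (2 * m + 1)) \<odot> ?y \<oplus> (nprod V D 1 ?y \<oplus> of_nat (2 * m + 1) \<odot> ?y)" by simp
  moreover have "\<dots> = nprod V D 1 ?y"
  proof -
    have "(- of_nat (2 * m + 1)) \<odot> ?y \<oplus> of_nat (2 * m + 1) \<odot> ?y = \<zero>"
      using y smult_add_left[of ?y "- of_nat (2 * m + 1)" "of_nat (2 * m + 1)"] by simp
    then show ?thesis using y Dcar by (simp add: M.add.m_lcomm)
  qed
  moreover have "nprod V \<phi> (- int m - 1) (nprod V D 1 c) \<ominus> nprod V D 1 ?y \<oplus> (nprod V D 1 ?y \<oplus>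
       of_nat (2 * m + 1) \<odot> ?y) = nprod V \<phi> (- int m - 1) (nprod V D 1 c) \<oplus>
       of_nat (2 * m + 1) \<odot> ?y"
    using y Dcar c car by (simp add: a_minus_def M.a_assoc M.l_neg M.r_neg1 M.r_neg2)
  ultimately show ?thesis by simp
qed

text \<open>
  An element killed by all \<open>x\<^sub>(\<^sub>m\<^sub>)\<close> with \<open>m \<ge> 0\<close> is killed by \<open>D\<^sub>(\<^sub>1\<^sub>)\<close>, and \<open>D\<^sub>(\<^sub>1\<^sub>)\<close> is diagonal on the PBW basis
  with a positive eigenvalue on every nonempty word.
\<close>

lemma fermion_kernel:
  assumes fermion: "fermion_vsa V psi psis" and b: "b \<in> carrier V"
    and kernel: "\<And>m. m \<ge> 0 \<Longrightarrow> nprod V (nprod V psi (-1) psis) m b = \<zero>"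
  shows "\<exists>s. b = s \<odot> vac V"
proof -
  have psi: "psi \<in> part V True" and psis: "psis \<in> part V True"
    and free: "freely_generated V [psi, psis]"
    using fermion by (auto simp: fermion_vsa_def)
  have car [simp]: "psi \<in> carrier V" "psis \<in> carrier V" using psi psis part_carrier by auto
  have br: "nprod V psi 0 psis = vac V" "\<And>j. j \<ge> 1 \<Longrightarrow> nprod V psi j psis = \<zero>"
    "\<And>j. j \<ge> 0 \<Longrightarrow> nprod V psi j psi = \<zero>" "\<And>j. j \<ge> 0 \<Longrightarrow> nprod V psis j psis = \<zero>"
  proof -
    have split: "j = 0 \<or> j = 1 \<or> j \<ge> 2" if "j \<ge> 0" for j :: int using that by auto
    show "nprod V psi 0 psis = vac V"
      using fermion by (auto simp: fermion_vsa_def lambda_bracket_def)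
    show "nprod V psi j psis = \<zero>" if "j \<ge> 1" for j
      using fermion split[of j] that by (auto simp: fermion_vsa_def lambda_bracket_def)
    show "nprod V psi j psi = \<zero>" if "j \<ge> 0" for j
      using fermion split[of j] that by (auto simp: fermion_vsa_def lambda_bracket_def)
    show "nprod V psis j psis = \<zero>" if "j \<ge> 0" for j
      using fermion split[of j] that by (auto simp: fermion_vsa_def lambda_bracket_def)
  qed
  define x where "x = nprod V psi (-1) psis"
  have x: "x \<in> part V False" using nprod_part[OF psi psis] by (simp add: x_def)
  then have xcar [simp]: "x \<in> carrier V" by (rule part_carrier)
  define D where "D = nprod V x (-1) x"
  have D: "D \<in> part V False" using nprod_part[OF x x] by (simp add: D_def)
  then have Dcar [simp]: "D \<in> carrier V" by (rule part_carrier)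
  have double: "y = \<zero>" if "y = (-1) \<odot> y" "y \<in> carrier V" for y
  proof (rule smult_eq_zero)
    have "2 \<odot> y = y \<oplus> y" using smult_add_left[of y 1 1] that(2) by simp
    also have "\<dots> = y \<oplus> (-1) \<odot> y" using that(1) by simp
    also have "\<dots> = \<zero>" using that(2) by (simp add: smult_minus_1 M.r_neg)
    finally show "2 \<odot> y = \<zero>" .
  qed (use that in auto)
  have psi_swap: "nprod V psi m (nprod V psi n c) = (-1) \<odot> nprod V psi n (nprod V psi m c)"
    if "c \<in> carrier V" for m n c
    using commute_if_nprods_vanish[OF psi psi that br(3), of m n] by (simp add: ssign_def)
  have psis_swap: "nprod V psis m (nprod V psis n c) = (-1) \<odot> nprod V psis n (nprod V psis m c)"
    if "c \<in> carrier V" for m n c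
    using commute_if_nprods_vanish[OF psis psis that br(4), of m n] by (simp add: ssign_def)
  have psi_x: "nprod V psi j x = (-1) \<odot> nprod V psi (-1) (nprod V psi j psis)" for j
    using psi_swap[of psis j "-1"] by (simp add: x_def)
  have psi_normal: "nprod V psi (-1) x = \<zero>"
    using double[OF psi_x[of "-1", folded x_def]] by simp
  have "nprod V psis (-1) psis = \<zero>"
    using double[OF psis_swap[of "vac V" "-1" "-1"]] by (simp add: nprod_vac)
  then have psis_psis: "nprod V psis j psis = \<zero>" if "j \<ge> -1" for j
    using br(4)[of j] that by (cases "j = -1") auto
  have psis_x: "nprod V psis j x = (if j = 0 then psis else \<zero>)" if "j \<ge> -1" for j
  proof -
    have "nprod V psi (-1) (nprod V psis j psis) \<ominus> (-1) \<odot> nprod V psis j x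
        = nprod V (vac V) (j - 1) psis"
      using commutator_two_terms[OF psi psis, of psis "-1" j] br(1,2)
      by (simp add: ssign_def x_def add.commute)
    then show ?thesis
      using psis_psis[OF that] by (simp add: vac_nprod a_minus_def smult_minus_1)
  qed
  have shift_psi: "nprod V D 1 (nprod V psi (- int m - 1) c) = nprod V psi (- int m - 1) (nprod V D 1 c)
      \<oplus> of_nat (2 * m + 1) \<odot> nprod V psi (- int m - 1) c" if "c \<in> carrier V" for m c
    unfolding D_def using psi_normal that
    by (intro sugawara_shift[OF psi x, of "-1"]) (simp_all add: psi_x br nprod_vac)
  have shift_psis: "nprod V D 1 (nprod V psis (- int m - 1) c) = nprod V psis (- int m - 1) (nprod V D 1 c)
      \<oplus> of_nat (2 * m + 1) \<odot> nprod V psis (- int m - 1) c" if "c \<in> carrier V" for m c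
    unfolding D_def using that by (intro sugawara_shift[OF psis x, of 1]) (simp_all add: psis_x)
  define energy :: "(nat \<times> nat) list \<Rightarrow> nat"
    where "energy w = (\<Sum>(i, m)\<leftarrow>w. 2 * m + 1)" for w
  let ?I = "pbw_words V [psi, psis]" and ?B = "monomial V [psi, psis]"
  have mono: "?B w \<in> carrier V \<and> nprod V D 1 (?B w) = of_nat (energy w) \<odot> ?B w"
    if "\<forall>(i, m)\<in>set w. i < 2" for w
    using that
  proof (induction w)
    case Nil
    then show ?case by (simp add: monomial_def energy_def nprod_vac_nonneg)
  next
    case (Cons l w)
    obtain i m where l: "l = (i, m)" by force
    define \<phi> where "\<phi> = [psi, psis] ! i"
    have i: "i = 0 \<or> i = 1" using Cons.prems l by auto
    then have phi: "\<phi> \<in> carrier V" by (auto simp: \<phi>_def)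
    have B: "?B (l # w) = nprod V \<phi> (- int m - 1) (?B w)"
      by (simp add: monomial_def l \<phi>_def)
    have IH: "?B w \<in> carrier V" "nprod V D 1 (?B w) = of_nat (energy w) \<odot> ?B w"
      using Cons by auto
    have "nprod V D 1 (?B (l # w)) = nprod V \<phi> (- int m - 1) (nprod V D 1 (?B w))
      \<oplus> of_nat (2 * m + 1) \<odot> nprod V \<phi> (- int m - 1) (?B w)"
      unfolding B using shift_psi[OF IH(1)] shift_psis[OF IH(1)] i by (auto simp: \<phi>_def)
    also have "\<dots> = (of_nat (energy w) + of_nat (2 * m + 1)) \<odot> ?B (l # w)"
      using IH phi unfolding B by (simp add: nprod_smult_right smult_add_left)
    also have "of_nat (energy w) + of_nat (2 * m + 1) = (of_nat (energy (l # w)) :: complex)"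
      by (simp add: energy_def l)
    finally show ?case using B IH phi by simp
  qed
  have basis: "basis_family V ?I ?B" using free by (simp add: freely_generated_def)
  obtain I0 c where I0: "finite I0" "I0 \<subseteq> ?I" and b_eq: "b = (\<Oplus>w\<in>I0. c w \<odot> ?B w)"
    using basis_family_span[OF basis b] by blast
  have I0_mono: "?B w \<in> carrier V" "nprod V D 1 (?B w) = of_nat (energy w) \<odot> ?B w"
    if "w \<in> I0" for w
    using mono[of w] that I0(2) by (auto simp: pbw_words_def numeral_2_eq_2)
  have "nprod V D 1 b = \<zero>"
    unfolding D_def
  proof (rule nprod_nprod_eq_zero[OF x x b])
    show "nprod V x (-1 - int j) (nprod V x (1 + int j) b) = \<zero>" for j
      using kernel[of "1 + int j"] by (simp add: x_def)
    show "nprod V x (1 + -1 - int j) (nprod V x (int j) b) = \<zero>" for j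
      using kernel[of "int j"] by (simp add: x_def)
  qed
  moreover have "nprod V D 1 b = (\<Oplus>w\<in>I0. (c w * of_nat (energy w)) \<odot> ?B w)"
    unfolding b_eq
  proof (subst nprod_finsum_right)
    show "(\<lambda>w. c w \<odot> ?B w) \<in> I0 \<rightarrow> carrier V" using I0_mono by simp
    show "(\<Oplus>w\<in>I0. nprod V D 1 (c w \<odot> ?B w)) = (\<Oplus>w\<in>I0. (c w * of_nat (energy w)) \<odot> ?B w)"
      using I0_mono by (intro M.finsum_cong') (auto simp: nprod_smult_right smult_smult)
  qed simp
  ultimately have zero: "(\<Oplus>w\<in>I0. (c w * of_nat (energy w)) \<odot> ?B w) = \<zero>" by simp
  have c0: "c w = 0" if "w \<in> I0" "w \<noteq> []" for w
  proof -
    have "energy w \<noteq> 0" using that(2) by (cases w) (auto simp: energy_def)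
    then show ?thesis using basis_family_independent[OF basis I0 zero that(1)] by simp
  qed
  have "b \<in> {s \<odot> vac V |s. True}"
    unfolding b_eq
  proof (rule M.finsum_in_subgroup)
    have "submodule {s \<odot> vac V |s. True} complex_ring V"
    proof (rule submoduleI)
      show "\<zero> \<in> {s \<odot> vac V |s. True}" by (intro CollectI exI[of _ 0]) simp
      show "\<ominus> a \<in> {s \<odot> vac V |s. True}" if "a \<in> {s \<odot> vac V |s. True}" for a
        using that by (auto simp: smult_smult simp flip: smult_minus_1)
      show "a \<oplus> b \<in> {s \<odot> vac V |s. True}"
        if "a \<in> {s \<odot> vac V |s. True}" "b \<in> {s \<odot> vac V |s. True}" for a b
        using that by (auto simp flip: smult_add_left)
    qed (auto simp: smult_smult)
    then show "subgroup {s \<odot> vac V |s. True} (add_monoid V)" by (rule submodule.axioms)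
    show "c w \<odot> ?B w \<in> {s \<odot> vac V |s. True}" if "w \<in> I0" for w
    proof (cases "w = []")
      case True
      then show ?thesis by (auto simp: monomial_def)
    next
      case False
      then show ?thesis
        using c0[OF that] I0_mono[OF that] by (intro CollectI exI[of _ 0]) simp
    qed
  qed
  then show ?thesis by blast
qed

end

section \<open>Central elements\<close>

lemma restrict_vsa_simps [simp]:
  "carrier (restrict_vsa V A) = A" "add (restrict_vsa V A) = add V" "zero (restrict_vsa V A) = zero V"
  "smult (restrict_vsa V A) = smult V" "vac (restrict_vsa V A) = vac V"
  "nprod (restrict_vsa V A) = nprod V" "part (restrict_vsa V A) p = part V p \<inter> A"
  by (simp_all add: restrict_vsa_def)

lemma monomial_restrict_vsa [simp]: "monomial (restrict_vsa V A) = monomial V"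
  by (intro ext) (simp add: monomial_def)

lemma finsum_restrict_vsa:
  assumes "vertex_superalgebra V" "vertex_superalgebra (restrict_vsa V A)" "A \<subseteq> carrier V"
    and "f \<in> I \<rightarrow> A"
  shows "finsum (restrict_vsa V A) f I = finsum V f I"
proof -
  interpret V: vertex_superalgebra V by fact
  interpret A: vertex_superalgebra "restrict_vsa V A" by fact
  show ?thesis
    by (rule additive_finsum[of "restrict_vsa V A" V "\<lambda>a. a"])
      (use assms A.M.abelian_group_axioms V.M.abelian_group_axioms in auto)
qed

context vertex_superalgebra
begin

lemma UNIV_bool_prod: "(UNIV :: (bool \<times> bool) set) = {(False, False), (False, True), (True, False), (True, True)}"
  by auto

lemma mode_bracket_even_right:
  assumes a: "a \<in> carrier V" and b: "b \<in> part V False" and c: "c \<in> carrier V"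
  shows "mode_bracket V a m b n c = nprod V a m (nprod V b n c) \<ominus> nprod V b n (nprod V a m c)"
proof -
  have bc: "b \<in> carrier V" using b by (rule part_carrier)
  obtain a0 a1 where a01: "a0 \<in> part V False" "a1 \<in> part V True" "a = a0 \<oplus> a1"
    using part_decompE[OF a] by blast
  have car: "a0 \<in> carrier V" "a1 \<in> carrier V" using a01 part_carrier by auto
  show ?thesis
    unfolding mode_bracket_def UNIV_bool_prod a01(3)
    using a01(1,2) b bc c car
    by (simp add: component_eq component_homogeneous ssign_def nprod_add_left nprod_add_right
        minus_conv_smult smult_add_right M.a_ac)
qed

lemma mode_bracket_even_left:
  assumes a: "a \<in> part V False" and b: "b \<in> carrier V" and c: "c \<in> carrier V"
  shows "mode_bracket V a m b n c = nprod V a m (nprod V b n c) \<ominus> nprod V b n (nprod V a m c)"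
proof -
  have ac: "a \<in> carrier V" using a by (rule part_carrier)
  obtain b0 b1 where b01: "b0 \<in> part V False" "b1 \<in> part V True" "b = b0 \<oplus> b1"
    using part_decompE[OF b] by blast
  have car: "b0 \<in> carrier V" "b1 \<in> carrier V" using b01 part_carrier by auto
  show ?thesis
    unfolding mode_bracket_def UNIV_bool_prod b01(3)
    using b01(1,2) a ac c car
    by (simp add: component_eq component_homogeneous ssign_def nprod_add_left nprod_add_right
        minus_conv_smult smult_add_right M.a_ac)
qed

text \<open>
  The brackets applied to the vacuum already contain all products \<open>a\<^sub>(\<^sub>n\<^sub>)b\<close> and \<open>b\<^sub>(\<^sub>n\<^sub>)a\<close> with \<open>n \<ge> 0\<close>: the
  nonnegative modes annihilate the vacuum and the \<open>(-1)\<close>-st modes create the two elements.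
\<close>

lemma even_mode_bracket_vacD:
  assumes a: "a \<in> carrier V" and b: "b \<in> part V False" and n: "n \<ge> 0"
    and comm: "\<And>m l. mode_bracket V a m b l (vac V) = \<zero>"
  shows "nprod V a n b = \<zero>" "nprod V b n a = \<zero>"
proof -
  have bc: "b \<in> carrier V" using b by (rule part_carrier)
  have *: "nprod V a m (nprod V b l (vac V)) \<ominus> nprod V b l (nprod V a m (vac V)) = \<zero>" for m l
    using comm mode_bracket_even_right[OF a b vac_carrier, of m l] by simp
  show "nprod V a n b = \<zero>"
    using *[of n "-1"] n a bc by (simp add: nprod_vac nprod_vac_nonneg)
  show "nprod V b n a = \<zero>"
    using *[of "-1" n] n a bc by (simp add: nprod_vac nprod_vac_nonneg minus_eq_zero_iff)
qed

text \<open>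
  By the commutator formula the products of nonnegative index determine all commutators of modes, so
  these are the even elements of the center; in this form closure under products is immediate
  from the associativity formula.
\<close>

definition even_center :: "'v set" where
  "even_center = {z \<in> part V False. \<forall>b\<in>carrier V. \<forall>n\<ge>0. nprod V z n b = \<zero>}"

lemma even_centerD:
  assumes "z \<in> even_center"
  shows "z \<in> part V False" "z \<in> carrier V" "b \<in> carrier V \<Longrightarrow> 0 \<le> n \<Longrightarrow> nprod V z n b = \<zero>"
  using assms part_carrier by (auto simp: even_center_def)

lemma even_center_submodule: "submodule even_center complex_ring V"
proof (rule submoduleI)
  show "\<ominus> a \<in> even_center" if "a \<in> even_center" for a
    using even_centerD[OF that]
    by (auto simp: even_center_def part_smult nprod_smult_left simp flip: smult_minus_1)
  show "s \<odot> a \<in> even_center" if "a \<in> even_center" for a s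
    using even_centerD[OF that] by (auto simp: even_center_def part_smult nprod_smult_left)
qed (auto simp: even_center_def part_carrier part_add nprod_add_left)

lemma vac_even_center: "vac V \<in> even_center"
  by (auto simp: even_center_def vac_even vac_nprod)

lemma nprod_even_center:
  assumes "a \<in> even_center" "b \<in> even_center"
  shows "nprod V a l b \<in> even_center"
  unfolding even_center_def
proof (intro CollectI conjI ballI allI impI)
  note a = even_centerD[OF assms(1)] and b = even_centerD[OF assms(2)]
  show "nprod V a l b \<in> part V False" using nprod_part[OF a(1) b(1)] by simp
  show "nprod V (nprod V a l b) n c = \<zero>" if "c \<in> carrier V" "n \<ge> 0" for n c
    by (rule nprod_nprod_eq_zero[OF a(1) b(1) that(1)]) (use a b that in simp_all)
qed

lemma even_center_fields_commute:
  assumes a: "a \<in> even_center" and b: "b \<in> carrier V"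
  shows "fields_commute V a b"
  unfolding fields_commute_def
proof (intro allI ballI)
  fix m n c assume c: "c \<in> carrier V"
  note a = even_centerD[OF a]
  obtain b0 b1 where b01: "b0 \<in> part V False" "b1 \<in> part V True" "b = b0 \<oplus> b1"
    using part_decompE[OF b] by blast
  have car: "b0 \<in> carrier V" "b1 \<in> carrier V" using b01 part_carrier by auto
  have "nprod V a m (nprod V b0 n c) = nprod V b0 n (nprod V a m c)"
    using commute_if_nprods_vanish[OF a(1) b01(1) c, of m n] a(2,3) car c
    by (simp add: ssign_def)
  moreover have "nprod V a m (nprod V b1 n c) = nprod V b1 n (nprod V a m c)"
    using commute_if_nprods_vanish[OF a(1) b01(2) c, of m n] a(2,3) car c
    by (simp add: ssign_def)
  ultimately show "mode_bracket V a m b n c = \<zero>"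
    unfolding mode_bracket_even_left[OF a(1) b c] unfolding b01(3)
    using a(2) car c by (simp add: nprod_add_left nprod_add_right minus_eq_zero_iff)
qed

lemma monomial_in:
  assumes "\<forall>(i, m)\<in>set w. i < length gs" "vac V \<in> X"
    and "\<And>g v m. g \<in> set gs \<Longrightarrow> v \<in> X \<Longrightarrow> nprod V g m v \<in> X"
  shows "monomial V gs w \<in> X"
  using assms(1)
proof (induction w)
  case Nil
  then show ?case using assms(2) by (simp add: monomial_def)
next
  case (Cons l w)
  then show ?case using assms(3) by (cases l) (auto simp: monomial_def)
qed

lemma freely_generated_in_submodule:
  assumes free: "freely_generated V gs" and X: "submodule X complex_ring V" "vac V \<in> X"
    and closed: "\<And>g v m. g \<in> set gs \<Longrightarrow> v \<in> X \<Longrightarrow> nprod V g m v \<in> X"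
    and v: "v \<in> carrier V"
  shows "v \<in> X"
proof -
  have basis: "basis_family V (pbw_words V gs) (monomial V gs)"
    using free by (simp add: freely_generated_def)
  obtain I0 c where I0: "I0 \<subseteq> pbw_words V gs" "v = (\<Oplus>w\<in>I0. c w \<odot> monomial V gs w)"
    using basis_family_span[OF basis v] by blast
  show ?thesis unfolding I0(2)
  proof (rule M.finsum_in_subgroup)
    show "subgroup X (add_monoid V)" using X(1) by (rule submodule.axioms(1))
    fix w assume "w \<in> I0"
    then have "\<forall>(i, m)\<in>set w. i < length gs" using I0(1) by (auto simp: pbw_words_def)
    then have "monomial V gs w \<in> X" using X(2) closed by (rule monomial_in)
    then show "c w \<odot> monomial V gs w \<in> X" using submoduleE(4)[OF X(1)] by simp
  qed
qed

text \<open>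
  A vertex algebra whose even generators have vanishing mutual brackets is commutative.  Induction
  along PBW monomials is needed twice: a generator kills every monomial, hence is central, and then
  every monomial is a product of central elements.
\<close>

lemma central_generators:
  assumes free: "freely_generated V gs" and even: "set gs \<subseteq> part V False"
    and comm: "\<And>a b j. a \<in> set gs \<Longrightarrow> b \<in> set gs \<Longrightarrow> 0 \<le> j \<Longrightarrow> nprod V a j b = \<zero>"
  shows "even_center = carrier V"
proof -
  have gs: "g \<in> even_center" if g: "g \<in> set gs" for g
  proof -
    have gp: "g \<in> part V False" "g \<in> carrier V" using g even part_carrier by auto
    let ?X = "{v \<in> carrier V. \<forall>j\<ge>0. nprod V g j v = \<zero>}"
    have "v \<in> ?X" if "v \<in> carrier V" for v
    proof (rule freely_generated_in_submodule[OF free _ _ _ that])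
      show "submodule ?X complex_ring V"
      proof (rule submoduleI)
        show "\<ominus> a \<in> ?X" if "a \<in> ?X" for a
          using that gp by (auto simp: nprod_smult_right simp flip: smult_minus_1)
      qed (use gp in \<open>auto simp: nprod_add_right nprod_smult_right\<close>)
      show "vac V \<in> ?X" using gp by (simp add: nprod_vac_nonneg)
      fix h v m assume h: "h \<in> set gs" and v: "v \<in> ?X"
      have hp: "h \<in> part V False" "h \<in> carrier V" using h even part_carrier by auto
      show "nprod V h m v \<in> ?X"
        using commute_if_nprods_vanish[OF gp(1) hp(1) _ comm[OF g h], of v] v gp hp
        by (auto simp: ssign_def)
    qed
    then show ?thesis using gp by (simp add: even_center_def)
  qed
  have "v \<in> even_center" if "v \<in> carrier V" for v
    by (rule freely_generated_in_submodule[OF free even_center_submodule vac_even_center _ that])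
      (use gs nprod_even_center in auto)
  then show ?thesis using even_centerD by blast
qed

end

section \<open>Tensor products and the free field algebra\<close>

text \<open>
  The elements of \<open>A \<otimes> B\<close> as finite sums \<open>\<Sum> b\<^sub>t \<otimes> t\<close> with unique coefficients \<open>b\<^sub>t \<in> A\<close>, for a basis \<open>T\<close> of
  \<open>B\<close>.  Expanding in the second factor alone reduces statements on \<open>A \<otimes> B\<close> to coefficients in \<open>A\<close>, to which
  facts on the vertex algebra \<open>A\<close> apply.
\<close>

lemma tensor_product_basis:
  assumes tensor: "is_tensor_product V A B"
  obtains T where "T \<subseteq> B"
    "\<forall>v\<in>carrier V. \<exists>T0 b. finite T0 \<and> T0 \<subseteq> T \<and> b \<in> T0 \<rightarrow> A \<and>
        v = (\<Oplus>\<^bsub>V\<^esub>t\<in>T0. nprod V (b t) (-1) t)"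
    "\<forall>T0 b. finite T0 \<longrightarrow> T0 \<subseteq> T \<longrightarrow> b \<in> T0 \<rightarrow> A \<longrightarrow>
        (\<Oplus>\<^bsub>V\<^esub>t\<in>T0. nprod V (b t) (-1) t) = \<zero>\<^bsub>V\<^esub> \<longrightarrow> (\<forall>t\<in>T0. b t = \<zero>\<^bsub>V\<^esub>)"
proof -
  interpret V: vertex_superalgebra V using tensor by (simp add: is_tensor_product_def)
  interpret A: vertex_superalgebra "restrict_vsa V A"
    using tensor by (simp add: is_tensor_product_def)
  have AB: "A \<subseteq> carrier V" "B \<subseteq> carrier V" using tensor by (auto simp: is_tensor_product_def)
  obtain S T where S: "basis_family (restrict_vsa V A) S (\<lambda>s. s)"
    and T: "basis_family (restrict_vsa V B) T (\<lambda>t. t)"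
    and ST: "basis_family V (S \<times> T) (\<lambda>(s, t). nprod V s (-1) t)"
    using tensor unfolding is_tensor_product_def by blast
  have SA: "S \<subseteq> A" and TB: "T \<subseteq> B" using S T by (auto simp: basis_family_def)
  have A_smult: "s \<odot>\<^bsub>V\<^esub> a \<in> A" if "a \<in> A" for s a
    using A.smult_closed[of s a] that by simp
  have A_finsum: "finsum V f I \<in> A" if "f \<in> I \<rightarrow> A" for f I
    using A.M.finsum_closed[of f I] that
      finsum_restrict_vsa[OF V.vertex_superalgebra_axioms A.vertex_superalgebra_axioms AB(1) that]
    by simp
  show thesis
  proof (rule that; (intro allI impI ballI)?)
    show "T \<subseteq> B" by (rule TB)
  next
    fix v assume "v \<in> carrier V"
    then obtain I0 c where I0: "finite I0" "I0 \<subseteq> S \<times> T"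
      and v: "v = (\<Oplus>\<^bsub>V\<^esub>i\<in>I0. c i \<odot>\<^bsub>V\<^esub> (case i of (s, t) \<Rightarrow> nprod V s (-1) t))"
      using V.basis_family_span[OF ST] by blast
    define fib where "fib t = {i \<in> I0. snd i = t}" for t
    define b where "b t = (\<Oplus>\<^bsub>V\<^esub>i\<in>fib t. c i \<odot>\<^bsub>V\<^esub> fst i)" for t
    have mem: "fst i \<in> A" "fst i \<in> carrier V" "snd i \<in> carrier V" if "i \<in> I0" for i
    proof -
      have "i \<in> S \<times> T" using that I0(2) by blast
      then show "fst i \<in> A" "fst i \<in> carrier V" "snd i \<in> carrier V" using SA TB AB by auto
    qed
    have summand: "c i \<odot>\<^bsub>V\<^esub> (case i of (s, t) \<Rightarrow> nprod V s (-1) t) \<in> carrier V" if "i \<in> I0" for i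
      using mem[OF that] by (auto split: prod.splits)
    have I0_eq: "I0 = \<Union> (fib ` (snd ` I0))" by (auto simp: fib_def)
    have "v = (\<Oplus>\<^bsub>V\<^esub>t\<in>snd ` I0. \<Oplus>\<^bsub>V\<^esub>i\<in>fib t. c i \<odot>\<^bsub>V\<^esub> (case i of (s, t) \<Rightarrow> nprod V s (-1) t))"
      unfolding v
      by (subst (1) I0_eq, rule V.M.add.finprod_UN_disjoint)
        (use I0(1) summand in \<open>auto simp: fib_def pairwise_def disjnt_def\<close>)
    also have "\<dots> = (\<Oplus>\<^bsub>V\<^esub>t\<in>snd ` I0. nprod V (b t) (-1) t)"
    proof (rule V.M.finsum_cong')
      fix t assume "t \<in> snd ` I0"
      then have t: "t \<in> carrier V" using mem by auto
      have fibc: "(\<lambda>i. c i \<odot>\<^bsub>V\<^esub> fst i) \<in> fib t \<rightarrow> carrier V" using mem by (auto simp: fib_def)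
      have "nprod V (b t) (-1) t = (\<Oplus>\<^bsub>V\<^esub>i\<in>fib t. nprod V (c i \<odot>\<^bsub>V\<^esub> fst i) (-1) t)"
        unfolding b_def by (rule V.nprod_finsum_left[OF t fibc])
      also have "\<dots> = (\<Oplus>\<^bsub>V\<^esub>i\<in>fib t. c i \<odot>\<^bsub>V\<^esub> (case i of (s, t) \<Rightarrow> nprod V s (-1) t))"
        using mem t by (intro V.M.finsum_cong') (auto simp: fib_def V.nprod_smult_left)
      finally show "(\<Oplus>\<^bsub>V\<^esub>i\<in>fib t. c i \<odot>\<^bsub>V\<^esub> (case i of (s, t) \<Rightarrow> nprod V s (-1) t)) = nprod V (b t) (-1) t"
        by simp
    next
      show "(\<lambda>t. nprod V (b t) (-1) t) \<in> snd ` I0 \<rightarrow> carrier V"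
        using mem by (auto simp: b_def fib_def intro!: V.nprod_closed V.M.finsum_closed)
    qed simp
    finally have "v = (\<Oplus>\<^bsub>V\<^esub>t\<in>snd ` I0. nprod V (b t) (-1) t)" .
    moreover have "b \<in> snd ` I0 \<rightarrow> A"
      unfolding b_def using mem by (auto intro!: A_finsum A_smult simp: fib_def)
    ultimately show "\<exists>T0 b. finite T0 \<and> T0 \<subseteq> T \<and> b \<in> T0 \<rightarrow> A \<and>
        v = (\<Oplus>\<^bsub>V\<^esub>t\<in>T0. nprod V (b t) (-1) t)"
      using I0 by (intro exI[of _ "snd ` I0"] exI[of _ b]) auto
  next
    fix T0 b t
    assume T0: "finite T0" "T0 \<subseteq> T" and b: "b \<in> T0 \<rightarrow> A"
      and zero: "(\<Oplus>\<^bsub>V\<^esub>t\<in>T0. nprod V (b t) (-1) t) = \<zero>\<^bsub>V\<^esub>" and t: "t \<in> T0"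
    have "\<exists>S0 c. finite S0 \<and> S0 \<subseteq> S \<and> b t = (\<Oplus>\<^bsub>V\<^esub>s\<in>S0. c s \<odot>\<^bsub>V\<^esub> s)" if "t \<in> T0" for t
    proof -
      have "b t \<in> carrier (restrict_vsa V A)" using b that by auto
      then obtain S0 c where S0: "finite S0" "S0 \<subseteq> S"
        "b t = (\<Oplus>\<^bsub>restrict_vsa V A\<^esub>s\<in>S0. c s \<odot>\<^bsub>restrict_vsa V A\<^esub> s)"
        by (rule A.basis_family_span[OF S])
      have "(\<lambda>s. c s \<odot>\<^bsub>V\<^esub> s) \<in> S0 \<rightarrow> A" using S0(2) SA A_smult by auto
      then have "b t = (\<Oplus>\<^bsub>V\<^esub>s\<in>S0. c s \<odot>\<^bsub>V\<^esub> s)"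
        using S0(3) finsum_restrict_vsa[OF V.vertex_superalgebra_axioms
            A.vertex_superalgebra_axioms AB(1)] by simp
      then show ?thesis using S0(1,2) by blast
    qed
    then obtain S0 c where S0: "\<And>t. t \<in> T0 \<Longrightarrow> finite (S0 t)" "\<And>t. t \<in> T0 \<Longrightarrow> S0 t \<subseteq> S"
      and b_eq: "\<And>t. t \<in> T0 \<Longrightarrow> b t = (\<Oplus>\<^bsub>V\<^esub>s\<in>S0 t. c t s \<odot>\<^bsub>V\<^esub> s)"
      by metis
    define d where "d i = c (snd i) (fst i)" for i
    let ?g = "\<lambda>i. d i \<odot>\<^bsub>V\<^esub> (case i of (s, t) \<Rightarrow> nprod V s (-1) t)"
    let ?K = "\<Union>t\<in>T0. (\<lambda>s. (s, t)) ` S0 t"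
    have car: "s \<in> carrier V" "t \<in> carrier V" if "t \<in> T0" "s \<in> S0 t" for s t
      using that S0 T0 SA TB AB by blast+
    have "finsum V ?g ?K = (\<Oplus>\<^bsub>V\<^esub>t\<in>T0. finsum V ?g ((\<lambda>s. (s, t)) ` S0 t))"
      using T0 S0 car
      by (intro V.M.add.finprod_UN_disjoint) (auto simp: pairwise_def disjnt_def)
    also have "\<dots> = (\<Oplus>\<^bsub>V\<^esub>t\<in>T0. nprod V (b t) (-1) t)"
    proof (rule V.M.finsum_cong')
      fix t assume t: "t \<in> T0"
      then have tc: "t \<in> carrier V" using T0 TB AB by blast
      have "finsum V ?g ((\<lambda>s. (s, t)) ` S0 t) = (\<Oplus>\<^bsub>V\<^esub>s\<in>S0 t. ?g (s, t))"
        using car[OF t] by (intro V.M.finsum_reindex) (auto simp: inj_on_def)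
      also have "\<dots> = (\<Oplus>\<^bsub>V\<^esub>s\<in>S0 t. nprod V (c t s \<odot>\<^bsub>V\<^esub> s) (-1) t)"
        using car[OF t] by (intro V.M.finsum_cong') (auto simp: d_def V.nprod_smult_left)
      also have "\<dots> = nprod V (b t) (-1) t"
        unfolding b_eq[OF t] using car[OF t] tc
        by (intro V.nprod_finsum_left[symmetric]) auto
      finally show "finsum V ?g ((\<lambda>s. (s, t)) ` S0 t) = nprod V (b t) (-1) t" .
    next
      show "(\<lambda>t. nprod V (b t) (-1) t) \<in> T0 \<rightarrow> carrier V"
        using b T0 TB AB by (auto intro!: V.nprod_closed)
    qed simp
    finally have zero': "finsum V ?g ?K = \<zero>\<^bsub>V\<^esub>" using zero by simp
    have "d (s, t) = 0" if "s \<in> S0 t" for s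
      by (rule V.basis_family_independent[OF ST _ _ zero'])
        (use T0 S0 t that in \<open>auto\<close>)
    then have "c t s = 0" if "s \<in> S0 t" for s using that by (auto simp: d_def)
    then show "b t = \<zero>\<^bsub>V\<^esub>"
      unfolding b_eq[OF t] using car[OF t] by (intro V.M.finsum_zeroI) simp
  qed
qed

text \<open>
  As \<open>x\<close> commutes with \<open>B\<close>, it acts on \<open>\<Sum> a\<^sub>t \<otimes> t\<close> coefficientwise; so each \<open>a\<^sub>t\<close> is killed by the nonnegative
  modes of \<open>x\<close> and is a multiple of the vacuum.
\<close>

lemma tensor_product_fermion_kernel:
  assumes tensor: "is_tensor_product V A B"
    and fermion: "fermion_vsa (restrict_vsa V A) psi psis"
    and B: "B \<subseteq> part V False"
    and v: "v \<in> carrier V"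
    and kernel: "\<And>m. 0 \<le> m \<Longrightarrow> nprod V (nprod V psi (-1) psis) m v = \<zero>\<^bsub>V\<^esub>"
  shows "v \<in> B"
proof -
  interpret V: vertex_superalgebra V using tensor by (simp add: is_tensor_product_def)
  interpret A: vertex_superalgebra "restrict_vsa V A"
    using tensor by (simp add: is_tensor_product_def)
  interpret B: vertex_superalgebra "restrict_vsa V B"
    using tensor by (simp add: is_tensor_product_def)
  have AB: "A \<subseteq> carrier V" "B \<subseteq> carrier V" using tensor by (auto simp: is_tensor_product_def)
  obtain T where T: "T \<subseteq> B"
    and span: "\<forall>v\<in>carrier V. \<exists>T0 b. finite T0 \<and> T0 \<subseteq> T \<and> b \<in> T0 \<rightarrow> A \<and>
        v = (\<Oplus>\<^bsub>V\<^esub>t\<in>T0. nprod V (b t) (-1) t)"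
    and indep: "\<forall>T0 b. finite T0 \<longrightarrow> T0 \<subseteq> T \<longrightarrow> b \<in> T0 \<rightarrow> A \<longrightarrow>
        (\<Oplus>\<^bsub>V\<^esub>t\<in>T0. nprod V (b t) (-1) t) = \<zero>\<^bsub>V\<^esub> \<longrightarrow> (\<forall>t\<in>T0. b t = \<zero>\<^bsub>V\<^esub>)"
    by (rule tensor_product_basis[OF tensor])
  obtain T0 a where T0: "finite T0" "T0 \<subseteq> T" and a: "a \<in> T0 \<rightarrow> A"
    and v_eq: "v = (\<Oplus>\<^bsub>V\<^esub>t\<in>T0. nprod V (a t) (-1) t)"
    using bspec[OF span v] by (elim exE conjE) (rule that)
  define x where "x = nprod V psi (-1) psis"
  have psi: "psi \<in> part V True" "psis \<in> part V True" "psi \<in> A" "psis \<in> A"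
    using fermion by (auto simp: fermion_vsa_def)
  have x: "x \<in> part V False" using V.nprod_part[OF psi(1,2)] by (simp add: x_def)
  have xA: "x \<in> A" using A.nprod_closed[of psi psis] psi by (simp add: x_def)
  have car: "a t \<in> A" "a t \<in> carrier V" "t \<in> B" "t \<in> carrier V" "t \<in> part V False" if "t \<in> T0" for t
    using that a T0 T AB B by blast+
  have cross: "nprod V s j t = \<zero>\<^bsub>V\<^esub>" if "s \<in> A" "t \<in> B" "0 \<le> j" for s t j
  proof (rule V.even_mode_bracket_vacD(1))
    show "mode_bracket V s m t l (vac V) = \<zero>\<^bsub>V\<^esub>" for m l
      using tensor that by (simp add: is_tensor_product_def fields_commute_def)
  qed (use that AB B in auto)
  have x_act: "nprod V x m (nprod V s (-1) t) = nprod V (nprod V x m s) (-1) t"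
    if "s \<in> A" "t \<in> B" "0 \<le> m" and s: "s \<in> part V q" for s t m q
  proof -
    have c: "s \<in> carrier V" "t \<in> carrier V" "x \<in> carrier V" using that AB xA by auto
    let ?f = "\<lambda>j. (complex_of_int m gchoose j) \<odot>\<^bsub>V\<^esub> nprod V (nprod V x (int j) s) (m + -1 - int j) t"
    obtain N0 where N0: "\<forall>N\<ge>N0. nprod V x m (nprod V s (-1) t) \<ominus>\<^bsub>V\<^esub>
        ssign False q \<odot>\<^bsub>V\<^esub> nprod V s (-1) (nprod V x m t) = finsum V ?f {..<N}"
      using V.commutator_formula[OF x s c(2), of m "-1"] by blast
    \<comment> \<open>for \<open>j < m\<close> the mode of \<open>x\<^sub>(\<^sub>j\<^sub>)s \<in> A\<close> acting on \<open>t \<in> B\<close> is nonnegative, for \<open>j > m\<close> the binomial vanishes\<close>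
    have "finsum V ?f {..<N0 + Suc (nat m)} = ?f (nat m)"
    proof (rule V.finsum_lessThan_single)
      show "?f \<in> UNIV \<rightarrow> carrier V" using c by simp
      show "?f j = \<zero>\<^bsub>V\<^esub>" if j: "j \<noteq> nat m" for j
      proof (cases "j < nat m")
        case True
        have "nprod V x (int j) s \<in> A" using A.nprod_closed[of x s] xA \<open>s \<in> A\<close> by simp
        then have "nprod V (nprod V x (int j) s) (m + -1 - int j) t = \<zero>\<^bsub>V\<^esub>"
          using cross \<open>t \<in> B\<close> True by simp
        then show ?thesis by simp
      next
        case False
        then have "complex_of_int (int (nat m)) gchoose j = 0"
          using j by (intro gchoose_eq_0_if_less) simp
        then show ?thesis using \<open>0 \<le> m\<close> c by simp
      qed
    qed simp
    moreover have "?f (nat m) = nprod V (nprod V x m s) (-1) t"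
    proof -
      have "complex_of_int m gchoose nat m = of_nat (nat m choose nat m)"
        using \<open>0 \<le> m\<close> by (metis binomial_gbinomial int_nat_eq of_int_of_nat_eq)
      then show ?thesis using \<open>0 \<le> m\<close> c by simp
    qed
    ultimately show ?thesis
      using N0[rule_format, of "N0 + Suc (nat m)"] cross[OF xA \<open>t \<in> B\<close> \<open>0 \<le> m\<close>] c
      by simp
  qed
  have x_act': "nprod V x m (nprod V s (-1) t) = nprod V (nprod V x m s) (-1) t"
    if that: "s \<in> A" "t \<in> B" "0 \<le> m" for s t m
  proof -
    have "s \<in> carrier (restrict_vsa V A)" using that by simp
    then obtain s0 s1 where "s0 \<in> part (restrict_vsa V A) False" "s1 \<in> part (restrict_vsa V A) True"
      "s = s0 \<oplus>\<^bsub>restrict_vsa V A\<^esub> s1" by (rule A.part_decompE)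
    then have s: "s0 \<in> part V False" "s0 \<in> A" "s1 \<in> part V True" "s1 \<in> A" "s = s0 \<oplus>\<^bsub>V\<^esub> s1"
      by auto
    have c: "s0 \<in> carrier V" "s1 \<in> carrier V" "t \<in> carrier V" "x \<in> carrier V"
      using s that(2) AB xA by auto
    show ?thesis
      using x_act[OF s(2) that(2,3) s(1)] x_act[OF s(4) that(2,3) s(3)] c
      by (simp add: s(5) V.nprod_add_left V.nprod_add_right)
  qed
  have "nprod V x m (a t) = \<zero>\<^bsub>V\<^esub>" if "0 \<le> m" "t \<in> T0" for m t
  proof (rule indep[rule_format, OF T0 _ _ that(2)])
    show "(\<lambda>t. nprod V x m (a t)) \<in> T0 \<rightarrow> A"
      using A.nprod_closed[of x] xA car by auto
    have "(\<Oplus>\<^bsub>V\<^esub>t\<in>T0. nprod V (nprod V x m (a t)) (-1) t) = (\<Oplus>\<^bsub>V\<^esub>t\<in>T0. nprod V x m (nprod V (a t) (-1) t))"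
      using x_act' car that(1) xA AB by (intro V.M.finsum_cong') auto
    also have "\<dots> = nprod V x m v"
      unfolding v_eq using car xA AB by (intro V.nprod_finsum_right[symmetric]) auto
    also have "\<dots> = \<zero>\<^bsub>V\<^esub>" using kernel[OF that(1)] by (simp add: x_def)
    finally show "(\<Oplus>\<^bsub>V\<^esub>t\<in>T0. nprod V (nprod V x m (a t)) (-1) t) = \<zero>\<^bsub>V\<^esub>" .
  qed
  then have scalar: "\<exists>s. a t = s \<odot>\<^bsub>V\<^esub> vac V" if "t \<in> T0" for t
    using A.fermion_kernel[OF fermion, of "a t"] car(1)[OF that] that by (simp add: x_def)
  have "nprod V (a t) (-1) t \<in> B" if t: "t \<in> T0" for t
  proof -
    obtain s where s: "a t = s \<odot>\<^bsub>V\<^esub> vac V" using scalar[OF t] by blast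
    have "nprod V (a t) (-1) t = s \<odot>\<^bsub>V\<^esub> t"
      unfolding s using car[OF t] by (simp add: V.nprod_smult_left V.vac_nprod)
    then show ?thesis using B.smult_closed[of s t] car(3)[OF t] by simp
  qed
  then show ?thesis
    unfolding v_eq using B.M.finsum_closed[of "\<lambda>t. nprod V (a t) (-1) t" T0]
      finsum_restrict_vsa[OF V.vertex_superalgebra_axioms B.vertex_superalgebra_axioms AB(2),
        of "\<lambda>t. nprod V (a t) (-1) t" T0] by auto
qed

text \<open>
  The level enters here: for \<open>k = -h\<^sup>\<or>\<close> the Heisenberg factor is central, so \<open>u\<^bsub>n+1\<^esub>\<close> drops out of the
  condition on \<open>v\<close>.  Brackets are tested on the vacuum only because this is what is known about
  the image of an element that commutes with \<open>J\<close> in a proper subalgebra.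
\<close>

lemma critical_current_commutant:
  assumes free: "free_field_vsa n kc F psi psis u" and kc: "kc = - dual_coxeter n"
    and v: "v \<in> carrier F" 
    and comm: "\<And>m l. mode_bracket F v m (heis_current n F psi psis u) l (vac F) = \<zero>\<^bsub>F\<^esub>"
  shows "v \<in> vertex_superalgebra.even_center F"
proof -
  obtain A H where tensor: "is_tensor_product F A H"
    and fermion: "fermion_vsa (restrict_vsa F A) psi psis"
    and heis: "heisenberg_vsa n kc (restrict_vsa F H) u"
    using free by (auto simp: free_field_vsa_def)
  interpret F: vertex_superalgebra F using tensor by (simp add: is_tensor_product_def)
  interpret A: vertex_superalgebra "restrict_vsa F A"
    using tensor by (simp add: is_tensor_product_def)
  interpret H: vertex_superalgebra "restrict_vsa F H"
    using tensor by (simp add: is_tensor_product_def)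
  have AH: "A \<subseteq> carrier F" "H \<subseteq> carrier F" using tensor by (auto simp: is_tensor_product_def)
  have u: "u i \<in> part F False" "u i \<in> H" if "i \<in> {1..n+1}" for i
    using heis that by (auto simp: heisenberg_vsa_def)
  have set_u: "set (map u [1..<n+2]) = u ` {1..n+1}"
    by (simp add: atLeastLessThanSuc_atLeastAtMost del: upt_Suc)
  have H_center: "H.even_center = H"
  proof -
    have "H.even_center = carrier (restrict_vsa F H)"
    proof (rule H.central_generators)
      show "freely_generated (restrict_vsa F H) (map u [1..<n+2])"
        using heis by (simp add: heisenberg_vsa_def)
      show "set (map u [1..<n+2]) \<subseteq> part (restrict_vsa F H) False"
        unfolding set_u using u by auto
      fix a b and j :: int
      assume "a \<in> set (map u [1..<n+2])" "b \<in> set (map u [1..<n+2])" and j: "0 \<le> j"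
      then obtain i i' where "i \<in> {1..n+1}" "i' \<in> {1..n+1}" and ab: "a = u i" "b = u i'"
        unfolding set_u by blast
      then have br: "lambda_bracket (restrict_vsa F H) (u i) (u i') \<zero>\<^bsub>F\<^esub> 0"
        using heis kc by (simp add: heisenberg_vsa_def)
      have "j = 0 \<or> j = 1 \<or> j \<ge> 2" using j by auto
      then show "nprod (restrict_vsa F H) a j b = \<zero>\<^bsub>restrict_vsa F H\<^esub>"
        using br by (auto simp: lambda_bracket_def ab)
    qed
    then show ?thesis by simp
  qed
  then have H_even: "H \<subseteq> part F False" and HH: "\<And>a b j. a \<in> H \<Longrightarrow> b \<in> H \<Longrightarrow> 0 \<le> j \<Longrightarrow> nprod F a j b = \<zero>\<^bsub>F\<^esub>"
    using H.even_centerD by auto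
  have HA: "nprod F h j a = \<zero>\<^bsub>F\<^esub>" if "h \<in> H" "a \<in> A" "0 \<le> j" for h a j
  proof (rule F.even_mode_bracket_vacD(2))
    show "mode_bracket F a m h l (vac F) = \<zero>\<^bsub>F\<^esub>" for m l
      using tensor that by (simp add: is_tensor_product_def fields_commute_def)
  qed (use that AH H_even in auto)
  have H_central: "h \<in> F.even_center" if h: "h \<in> H" for h
  proof -
    have hp: "h \<in> part F False" "h \<in> carrier F" using h H_even AH by auto
    obtain T where T: "T \<subseteq> H"
      and span: "\<forall>v\<in>carrier F. \<exists>T0 b. finite T0 \<and> T0 \<subseteq> T \<and> b \<in> T0 \<rightarrow> A \<and>
        v = (\<Oplus>\<^bsub>F\<^esub>t\<in>T0. nprod F (b t) (-1) t)"
      by (rule tensor_product_basis[OF tensor])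
    have step: "nprod F h j (nprod F a (-1) t) = \<zero>\<^bsub>F\<^esub>"
      if "a \<in> part F q" "a \<in> A" "t \<in> H" "0 \<le> j" for a t j q
      using F.commute_if_nprods_vanish[OF hp(1) that(1), of t j "-1"] HA[OF h that(2)]
        HH[OF h that(3)] that AH by (auto simp: subset_iff)
    have step': "nprod F h j (nprod F a (-1) t) = \<zero>\<^bsub>F\<^esub>"
      if at: "a \<in> A" "t \<in> H" "0 \<le> j" for a t j
    proof -
      have "a \<in> carrier (restrict_vsa F A)" using at by simp
      then obtain a0 a1 where "a0 \<in> part (restrict_vsa F A) False"
        "a1 \<in> part (restrict_vsa F A) True" "a = a0 \<oplus>\<^bsub>restrict_vsa F A\<^esub> a1"
        by (rule A.part_decompE)
      then have a: "a0 \<in> part F False" "a0 \<in> A" "a1 \<in> part F True" "a1 \<in> A" "a = a0 \<oplus>\<^bsub>F\<^esub> a1"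
        by auto
      have c: "a0 \<in> carrier F" "a1 \<in> carrier F" "t \<in> carrier F" using a at AH by auto
      show ?thesis
        using step[OF a(1,2) at(2,3)] step[OF a(3,4) at(2,3)] c hp
        by (simp add: a(5) F.nprod_add_left F.nprod_add_right)
    qed
    have "nprod F h j b = \<zero>\<^bsub>F\<^esub>" if b: "b \<in> carrier F" "0 \<le> j" for b j
    proof -
      obtain T0 a where T0: "T0 \<subseteq> T" "a \<in> T0 \<rightarrow> A" "b = (\<Oplus>\<^bsub>F\<^esub>t\<in>T0. nprod F (a t) (-1) t)"
        using bspec[OF span b(1)] by (elim exE conjE) (rule that)
      have "(\<lambda>t. nprod F (a t) (-1) t) \<in> T0 \<rightarrow> carrier F"
        using T0(1,2) T AH by (auto intro!: F.nprod_closed)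
      then have "nprod F h j b = (\<Oplus>\<^bsub>F\<^esub>t\<in>T0. nprod F h j (nprod F (a t) (-1) t))"
        unfolding T0(3) by (rule F.nprod_finsum_right[OF hp(2)])
      also have "\<dots> = \<zero>\<^bsub>F\<^esub>"
        using T0(1,2) T b(2) by (intro F.M.finsum_zeroI step') auto
      finally show ?thesis .
    qed
    then show ?thesis using hp by (simp add: F.even_center_def)
  qed
  define x where "x = nprod F psi (-1) psis"
  have psi: "psi \<in> part F True" "psis \<in> part F True" using fermion by (auto simp: fermion_vsa_def)
  have x: "x \<in> part F False" using F.nprod_part[OF psi] by (simp add: x_def)
  have uc: "u (n + 1) \<in> carrier F" "x \<in> carrier F" using u[of "n + 1"] x F.part_carrier by auto
  have J: "heis_current n F psi psis u = x \<ominus>\<^bsub>F\<^esub> u (n + 1)" by (simp add: heis_current_def x_def)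
  have "nprod F x m v = \<zero>\<^bsub>F\<^esub>" if m: "0 \<le> m" for m
  proof -
    have "nprod F (x \<ominus>\<^bsub>F\<^esub> u (n + 1)) m v = \<zero>\<^bsub>F\<^esub>"
      using F.even_mode_bracket_vacD(2)[OF v _ m comm] F.part_minus[OF x u(1)] by (simp add: J)
    moreover have "nprod F (u (n + 1)) m v = \<zero>\<^bsub>F\<^esub>"
      using F.even_centerD(3)[OF H_central[OF u(2)] v m] by simp
    ultimately show ?thesis
      using uc v by (simp add: F.minus_conv_smult F.nprod_add_left F.nprod_smult_left)
  qed
  then have "v \<in> H"
    using tensor_product_fermion_kernel[OF tensor fermion H_even v] by (simp add: x_def)
  then show ?thesis by (rule H_central)
qed

section \<open>Subquotients of vertex superalgebras\<close>

text \<open>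
  The quotient of a vertex subalgebra \<open>Z\<close> by an ideal \<open>B\<close> of \<open>Z\<close>, which need not be an ideal of \<open>V\<close>: as
  for coboundaries, products with elements outside \<open>Z\<close> may leave \<open>B\<close>.
\<close>

locale vsa_subquotient = vertex_superalgebra V for V :: "'v vsa" (structure) +
  fixes Z B :: "'v set"
  assumes Z_submodule: "submodule Z complex_ring V"
    and B_submodule: "submodule B complex_ring V"
    and Z_nprod: "a \<in> Z \<Longrightarrow> b \<in> Z \<Longrightarrow> nprod V a m b \<in> Z"
    and B_nprod_left: "b \<in> B \<Longrightarrow> a \<in> Z \<Longrightarrow> nprod V b m a \<in> B"
    and B_nprod_right: "a \<in> Z \<Longrightarrow> b \<in> B \<Longrightarrow> nprod V a m b \<in> B"
    and B_subset: "B \<subseteq> Z"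
    and Z_vac: "vac V \<in> Z"
    and Z_parts: "a \<in> Z \<Longrightarrow>
      \<exists>a0 a1. a0 \<in> Z \<inter> part V False \<and> a1 \<in> Z \<inter> part V True \<and> a = a0 \<oplus> a1"
begin

abbreviation cls :: "'v \<Rightarrow> 'v set" where "cls a \<equiv> B +>\<^bsub>V\<^esub> a"

abbreviation W :: "'v set vsa" where "W \<equiv> quotient_vsa V Z B"

lemma Z_carrier: "a \<in> Z \<Longrightarrow> a \<in> carrier V"
  using submoduleE(1)[OF Z_submodule] by auto

lemma B_carrier: "a \<in> B \<Longrightarrow> a \<in> carrier V"
  using submoduleE(1)[OF B_submodule] by auto

lemma B_subgroup: "subgroup B (add_monoid V)"
  by (rule submodule.axioms(1)[OF B_submodule])

lemma Z_add: "a \<in> Z \<Longrightarrow> b \<in> Z \<Longrightarrow> a \<oplus> b \<in> Z"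
  by (rule submoduleE(5)[OF Z_submodule])

lemma Z_smult: "a \<in> Z \<Longrightarrow> s \<odot> a \<in> Z"
  using submoduleE(4)[OF Z_submodule] by simp

lemma B_add: "a \<in> B \<Longrightarrow> b \<in> B \<Longrightarrow> a \<oplus> b \<in> B"
  by (rule submoduleE(5)[OF B_submodule])

lemma B_smult: "a \<in> B \<Longrightarrow> s \<odot> a \<in> B"
  using submoduleE(4)[OF B_submodule] by simp

lemma zero_Z: "\<zero> \<in> Z"
  using Z_smult[OF Z_vac, of 0] by simp

lemma cls_iff: "x \<in> cls a \<longleftrightarrow> (\<exists>b\<in>B. x = b \<oplus> a)"
  by (auto simp: a_r_coset_def')

lemma cls_cong: "x \<in> cls a \<Longrightarrow> a \<in> carrier V \<Longrightarrow> cls x = cls a"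
  using M.a_repr_independence[OF _ _ B_subgroup] by simp

lemma self_cls: "a \<in> carrier V \<Longrightarrow> a \<in> cls a"
  using subgroup.one_closed[OF B_subgroup] by (force simp: cls_iff)

lemma UN_cls_eqI:
  assumes "a \<in> carrier V" "\<And>x. x \<in> cls a \<Longrightarrow> f x = y"
  shows "(\<Union>x\<in>cls a. f x) = y"
  using assms self_cls[OF assms(1)] by blast

lemma W_carrier: "carrier W = cls ` Z" and W_zero: "\<zero>\<^bsub>W\<^esub> = B" and W_vac: "vac W = cls (vac V)"
  and W_part: "part W p = cls ` (Z \<inter> part V p)"
  by (simp_all add: quotient_vsa_def)

lemma W_zero': "\<zero>\<^bsub>W\<^esub> = cls \<zero>"
proof -
  have "cls \<zero> = B" using B_carrier by (force simp: cls_iff)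
  then show ?thesis by (simp add: W_zero)
qed

lemma W_add: "a \<in> carrier V \<Longrightarrow> b \<in> carrier V \<Longrightarrow> cls a \<oplus>\<^bsub>W\<^esub> cls b = cls (a \<oplus> b)"
  using abelian_subgroup.a_rcos_sum[OF abelian_subgroupI3] B_subgroup M.abelian_group_axioms
  by (simp add: quotient_vsa_def additive_subgroup_def)

lemma W_smult: "a \<in> carrier V \<Longrightarrow> s \<odot>\<^bsub>W\<^esub> cls a = cls (s \<odot> a)"
  unfolding quotient_vsa_def module.select_convs
proof (rule UN_cls_eqI)
  fix x assume a: "a \<in> carrier V" and "x \<in> cls a"
  then obtain b where "b \<in> B" "x = b \<oplus> a" by (auto simp: cls_iff)
  then have "s \<odot> x \<in> cls (s \<odot> a)"
    using a B_carrier B_smult by (auto simp: cls_iff smult_add_right)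
  then show "cls (s \<odot> x) = cls (s \<odot> a)" using a by (intro cls_cong) auto
qed

lemma W_nprod:
  assumes "a \<in> Z" "b \<in> Z"
  shows "nprod W (cls a) m (cls b) = cls (nprod V a m b)"
proof -
  have ab: "a \<in> carrier V" "b \<in> carrier V" using assms Z_carrier by auto
  have "cls (nprod V x m y) = cls (nprod V a m b)" if xy: "x \<in> cls a" "y \<in> cls b" for x y
  proof -
    obtain c d where cd: "c \<in> B" "d \<in> B" "x = c \<oplus> a" "y = d \<oplus> b"
      using xy by (auto simp: cls_iff)
    have car: "c \<in> carrier V" "d \<in> carrier V" using cd B_carrier by auto
    have "nprod V x m y = (nprod V c m (d \<oplus> b) \<oplus> nprod V a m d) \<oplus> nprod V a m b"
      using car ab by (simp add: cd nprod_add_left nprod_add_right M.a_ac)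
    moreover have "nprod V c m (d \<oplus> b) \<oplus> nprod V a m d \<in> B"
      using cd assms B_subset by (intro B_add B_nprod_left B_nprod_right Z_add) auto
    ultimately have "nprod V x m y \<in> cls (nprod V a m b)" by (auto simp: cls_iff)
    then show ?thesis using ab by (intro cls_cong) auto
  qed
  then have "(\<Union>x\<in>cls a. \<Union>y\<in>cls b. cls (nprod V x m y)) = cls (nprod V a m b)"
    using ab by (intro UN_cls_eqI) auto
  then show ?thesis by (simp add: quotient_vsa_def)
qed

lemma W_abelian_group: "abelian_group W"
proof (rule abelian_groupI)
  show "\<exists>Y\<in>carrier W. Y \<oplus>\<^bsub>W\<^esub> X = \<zero>\<^bsub>W\<^esub>" if X: "X \<in> carrier W" for X
  proof -
    obtain a where a: "a \<in> Z" "X = cls a" using X by (auto simp: W_carrier)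
    then have "cls ((-1) \<odot> a) \<oplus>\<^bsub>W\<^esub> X = \<zero>\<^bsub>W\<^esub>"
      using Z_carrier by (simp add: W_add W_zero' smult_minus_1 M.l_neg)
    then show ?thesis using Z_smult[OF a(1)] by (auto simp: W_carrier)
  qed
qed (use Z_carrier Z_add zero_Z in \<open>auto simp: W_carrier W_add W_zero' M.a_ac\<close>)

lemma W_smult_closed: "X \<in> carrier W \<Longrightarrow> s \<odot>\<^bsub>W\<^esub> X \<in> carrier W"
  using Z_carrier Z_smult by (auto simp: W_carrier W_smult)

lemma W_nprod_closed: "X \<in> carrier W \<Longrightarrow> Y \<in> carrier W \<Longrightarrow> nprod W X m Y \<in> carrier W"
  using Z_nprod by (auto simp: W_carrier W_nprod)

lemma W_vac_closed: "vac W \<in> carrier W"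
  using Z_vac by (auto simp: W_carrier W_vac)

lemma W_parts:
  assumes "X \<in> carrier W"
  shows "\<exists>X0\<in>part W False. \<exists>X1\<in>part W True. X = X0 \<oplus>\<^bsub>W\<^esub> X1"
proof -
  obtain a where a: "a \<in> Z" "X = cls a" using assms by (auto simp: W_carrier)
  obtain a0 a1 where "a0 \<in> Z \<inter> part V False" "a1 \<in> Z \<inter> part V True" "a = a0 \<oplus> a1"
    using Z_parts[OF a(1)] by blast
  then show ?thesis
    using a part_carrier by (intro bexI[of _ "cls a0"] bexI[of _ "cls a1"]) (auto simp: W_part W_add)
qed

end

section \<open>Embeddings and commutativity\<close>

text \<open>
  The source is only required to be a graded space closed under its products, because injectivity of
  the map into a vertex superalgebra makes parity components unique.
\<close>

locale vsa_embedded = W: abelian_group W + F: vertex_superalgebra F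
  for W :: "'w vsa" and F :: "'v vsa" +
  fixes \<phi> :: "'w \<Rightarrow> 'v"
  assumes embedding: "vsa_embedding W F \<phi>"
    and smult_closed: "a \<in> carrier W \<Longrightarrow> s \<odot>\<^bsub>W\<^esub> a \<in> carrier W"
    and nprod_closed: "a \<in> carrier W \<Longrightarrow> b \<in> carrier W \<Longrightarrow> nprod W a m b \<in> carrier W"
    and part_carrier: "a \<in> part W p \<Longrightarrow> a \<in> carrier W"
    and parts: "a \<in> carrier W \<Longrightarrow> \<exists>a0\<in>part W False. \<exists>a1\<in>part W True. a = a0 \<oplus>\<^bsub>W\<^esub> a1"
begin

lemma hom:
  "a \<in> carrier W \<Longrightarrow> \<phi> a \<in> carrier F"
  "a \<in> carrier W \<Longrightarrow> b \<in> carrier W \<Longrightarrow> \<phi> (a \<oplus>\<^bsub>W\<^esub> b) = \<phi> a \<oplus>\<^bsub>F\<^esub> \<phi> b"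
  "a \<in> carrier W \<Longrightarrow> \<phi> (s \<odot>\<^bsub>W\<^esub> a) = s \<odot>\<^bsub>F\<^esub> \<phi> a"
  "a \<in> carrier W \<Longrightarrow> b \<in> carrier W \<Longrightarrow> \<phi> (nprod W a m b) = nprod F (\<phi> a) m (\<phi> b)"
  "a \<in> part W p \<Longrightarrow> \<phi> a \<in> part F p"
  using embedding unfolding vsa_embedding_def by blast+

lemma hom_vac: "\<phi> (vac W) = vac F"
  using embedding unfolding vsa_embedding_def by blast

lemma hom_inj: "a \<in> carrier W \<Longrightarrow> b \<in> carrier W \<Longrightarrow> \<phi> a = \<phi> b \<Longrightarrow> a = b"
  using embedding unfolding vsa_embedding_def inj_on_def by blast

sublocale abelian_group_hom W F \<phi>
  using hom(1,2) by (intro abelian_group_homI W.abelian_group_axioms F.M.abelian_group_axioms)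
    (auto simp: group_hom_def group_hom_axioms_def hom_def W.a_group F.M.a_group)

lemma hom_minus: "a \<in> carrier W \<Longrightarrow> b \<in> carrier W \<Longrightarrow> \<phi> (a \<ominus>\<^bsub>W\<^esub> b) = \<phi> a \<ominus>\<^bsub>F\<^esub> \<phi> b"
  by (simp add: a_minus_def)

lemma component_closed_hom:
  assumes a: "a \<in> carrier W"
  shows "component W p a \<in> carrier W \<and> \<phi> (component W p a) = component F p (\<phi> a)"
proof -
  obtain a0 a1 where a01: "a0 \<in> part W False" "a1 \<in> part W True" "a = a0 \<oplus>\<^bsub>W\<^esub> a1"
    using parts[OF a] by blast
  define b c where "b = (if p then a1 else a0)" and "c = (if p then a0 else a1)"
  have b: "b \<in> part W p" and c: "c \<in> part W (\<not> p)" and abc: "a = b \<oplus>\<^bsub>W\<^esub> c"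
    using a01 part_carrier by (auto simp: b_def c_def W.a_comm)
  have comp: "\<phi> x = component F p (\<phi> a)"
    if "x \<in> part W p" "y \<in> part W (\<not> p)" "a = x \<oplus>\<^bsub>W\<^esub> y" for x y
  proof (cases p)
    case True
    then have "\<phi> a = \<phi> y \<oplus>\<^bsub>F\<^esub> \<phi> x"
      using that hom part_carrier F.M.a_comm by simp
    then show ?thesis using F.component_eq[of "\<phi> y" "\<phi> x" p] that hom(5) True by auto
  next
    case False
    then have "\<phi> a = \<phi> x \<oplus>\<^bsub>F\<^esub> \<phi> y" using that hom part_carrier by simp
    then show ?thesis using F.component_eq[of "\<phi> x" "\<phi> y" p] that hom(5) False by auto
  qed
  have "component W p a = b"
    unfolding component_def
  proof (rule the_equality)
    show "b \<in> part W p \<and> (\<exists>a''\<in>part W (\<not> p). a = b \<oplus>\<^bsub>W\<^esub> a'')" using b c abc by blast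
    fix x assume "x \<in> part W p \<and> (\<exists>a''\<in>part W (\<not> p). a = x \<oplus>\<^bsub>W\<^esub> a'')"
    then show "x = b" using comp b c abc part_carrier by (metis hom_inj)
  qed
  then show ?thesis using comp[OF b c abc] b part_carrier by simp
qed

lemma hom_mode_bracket:
  assumes "a \<in> carrier W" "b \<in> carrier W" "c \<in> carrier W"
  shows "\<phi> (mode_bracket W a m b n c) = mode_bracket F (\<phi> a) m (\<phi> b) n (\<phi> c)"
    "mode_bracket W a m b n c \<in> carrier W"
proof -
  note comp = component_closed_hom[OF assms(1), THEN conjunct1]
    component_closed_hom[OF assms(2), THEN conjunct1]
    component_closed_hom[OF assms(1), THEN conjunct2]
    component_closed_hom[OF assms(2), THEN conjunct2]
  let ?t = "\<lambda>(p, q). nprod W (component W p a) m (nprod W (component W q b) n c) \<ominus>\<^bsub>W\<^esub>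
     ssign p q \<odot>\<^bsub>W\<^esub> nprod W (component W q b) n (nprod W (component W p a) m c)"
  have t: "?t \<in> UNIV \<rightarrow> carrier W"
    using comp assms by (auto intro!: nprod_closed smult_closed W.minus_closed)
  show "mode_bracket W a m b n c \<in> carrier W"
    unfolding mode_bracket_def using t by (rule W.finsum_closed)
  have "\<phi> (finsum W ?t UNIV) = finsum F (\<lambda>i. \<phi> (?t i)) UNIV"
    by (rule additive_finsum)
      (use hom t W.abelian_group_axioms F.M.abelian_group_axioms in auto)
  also have "(\<lambda>i. \<phi> (?t i)) = (\<lambda>(p, q). nprod F (component F p (\<phi> a)) m
        (nprod F (component F q (\<phi> b)) n (\<phi> c)) \<ominus>\<^bsub>F\<^esub>
     ssign p q \<odot>\<^bsub>F\<^esub> nprod F (component F q (\<phi> b)) n (nprod F (component F p (\<phi> a)) m (\<phi> c)))"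
    using comp assms by (auto simp: fun_eq_iff hom_minus hom nprod_closed smult_closed)
  finally show "\<phi> (mode_bracket W a m b n c) = mode_bracket F (\<phi> a) m (\<phi> b) n (\<phi> c)"
    by (simp add: mode_bracket_def)
qed

lemma fields_commute_iff:
  assumes "a \<in> carrier W" "b \<in> carrier W"
  shows "fields_commute W a b \<longleftrightarrow>
    (\<forall>m n. \<forall>c\<in>carrier W. mode_bracket F (\<phi> a) m (\<phi> b) n (\<phi> c) = \<zero>\<^bsub>F\<^esub>)"
proof -
  have "mode_bracket W a m b n c = \<zero>\<^bsub>W\<^esub> \<longleftrightarrow> mode_bracket F (\<phi> a) m (\<phi> b) n (\<phi> c) = \<zero>\<^bsub>F\<^esub>"
    if "c \<in> carrier W" for m n c
    using hom_mode_bracket[OF assms that, of m n]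
    by (metis hom_inj hom_zero W.zero_closed)
  then show ?thesis by (simp add: fields_commute_def)
qed

end

section \<open>The cohomology of an odd differential\<close>

text \<open>
  Here \<open>D d\<close> is the space of cohomological degree \<open>d\<close>, which is independent of parity, and \<open>Q\<^sub>(\<^sub>0\<^sub>)\<close> is
  the differential.
\<close>

locale odd_differential = vertex_superalgebra V for V :: "'v vsa" (structure) +
  fixes Q :: 'v and D :: "int \<Rightarrow> 'v set"
  assumes Q_odd: "Q \<in> part V True"
    and D_submodule: "submodule (D d) complex_ring V"
    and D_vac: "vac V \<in> D 0"
    and D_nprod: "a \<in> D d \<Longrightarrow> b \<in> D d' \<Longrightarrow> nprod V a m b \<in> D (d + d')"
    and D_parts: "a \<in> D d \<Longrightarrow>
      \<exists>a0 a1. a0 \<in> D d \<inter> part V False \<and> a1 \<in> D d \<inter> part V True \<and> a = a0 \<oplus> a1"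
begin

definition cycles :: "'v set" where
  "cycles = {a \<in> D 0. nprod V Q 0 a = \<zero>}"

definition boundaries :: "'v set" where
  "boundaries = nprod V Q 0 ` D (-1) \<inter> cycles"

lemma Q_carrier [simp]: "Q \<in> carrier V"
  using Q_odd by (rule part_carrier)

lemma D_carrier: "a \<in> D d \<Longrightarrow> a \<in> carrier V"
  using submoduleE(1)[OF D_submodule] by auto

lemma D_add: "a \<in> D d \<Longrightarrow> b \<in> D d \<Longrightarrow> a \<oplus> b \<in> D d"
  by (rule submoduleE(5)[OF D_submodule])

lemma D_smult: "a \<in> D d \<Longrightarrow> s \<odot> a \<in> D d"
  using submoduleE(4)[OF D_submodule] by simp

lemma D_zero: "\<zero> \<in> D d"
  using submodule.axioms(1)[OF D_submodule] subgroup.one_closed by fastforce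

lemma cycles_parts:
  assumes "a \<in> cycles"
  obtains a0 a1 where "a0 \<in> cycles" "a0 \<in> part V False" "a1 \<in> cycles" "a1 \<in> part V True"
    "a = a0 \<oplus> a1"
proof -
  obtain a0 a1 where a: "a0 \<in> D 0 \<inter> part V False" "a1 \<in> D 0 \<inter> part V True" "a = a0 \<oplus> a1"
    using D_parts[of a 0] assms by (auto simp: cycles_def)
  have car: "a0 \<in> carrier V" "a1 \<in> carrier V" using a part_carrier by auto
  have "nprod V Q 0 a1 \<in> part V False" "nprod V Q 0 a0 \<in> part V True"
    using nprod_part[OF Q_odd, of a1 True 0] nprod_part[OF Q_odd, of a0 False 0] a by auto
  moreover have "nprod V Q 0 a1 \<oplus> nprod V Q 0 a0 = \<zero> \<oplus> \<zero>"
    using assms car a(3) by (simp add: cycles_def nprod_add_right M.a_comm)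
  ultimately have "nprod V Q 0 a1 = \<zero> \<and> nprod V Q 0 a0 = \<zero>"
    by (intro part_unique) auto
  then show thesis using that[of a0 a1] a by (auto simp: cycles_def)
qed

lemma cycles_submodule: "submodule cycles complex_ring V"
proof (rule submoduleI)
  show "\<ominus> a \<in> cycles" if "a \<in> cycles" for a
    using that D_carrier D_smult[of a 0 "-1"]
    by (auto simp: cycles_def nprod_smult_right simp flip: smult_minus_1)
qed (use D_carrier D_zero D_add D_smult in
    \<open>auto simp: cycles_def nprod_add_right nprod_smult_right\<close>)

lemma cycles_nprod_homogeneous:
  assumes a: "a \<in> cycles" "a \<in> part V p" and b: "b \<in> cycles"
  shows "nprod V a m b \<in> cycles"
  using zero_mode_derivation[OF Q_odd a(2), of b m] D_nprod[of a 0 b 0 m] D_carrier a b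
  by (auto simp: cycles_def)

lemma cycles_nprod:
  assumes a: "a \<in> cycles" and b: "b \<in> cycles"
  shows "nprod V a m b \<in> cycles"
proof -
  obtain a0 a1 where s: "a0 \<in> cycles" "a0 \<in> part V False" "a1 \<in> cycles" "a1 \<in> part V True"
    "a = a0 \<oplus> a1"
    using a by (rule cycles_parts)
  have "nprod V a m b = nprod V a0 m b \<oplus> nprod V a1 m b"
    using s b D_carrier by (auto simp: cycles_def nprod_add_left)
  then show ?thesis
    using s b cycles_nprod_homogeneous submoduleE(5)[OF cycles_submodule] by metis
qed

lemma boundariesI: "b \<in> D (-1) \<Longrightarrow> c = nprod V Q 0 b \<Longrightarrow> c \<in> cycles \<Longrightarrow> c \<in> boundaries"
  by (auto simp: boundaries_def)

lemma boundaries_submodule: "submodule boundaries complex_ring V"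
proof (rule submoduleI)
  note cyc = submoduleE[OF cycles_submodule]
  show smult: "s \<odot> a \<in> boundaries" if a: "a \<in> boundaries" for s a
  proof -
    obtain b where b: "b \<in> D (-1)" "a = nprod V Q 0 b" "a \<in> cycles"
      using a by (auto simp: boundaries_def)
    show ?thesis
      using D_smult[OF b(1)] D_carrier[OF b(1)] cyc(4)[of s a] b
      by (intro boundariesI[of "s \<odot> b"]) (auto simp: nprod_smult_right)
  qed
  show "\<ominus> a \<in> boundaries" if "a \<in> boundaries" for a
    using smult[OF that, of "-1"] that D_carrier
    by (auto simp: boundaries_def cycles_def smult_minus_1)
  show "a \<oplus> a' \<in> boundaries" if a: "a \<in> boundaries" "a' \<in> boundaries" for a a'
  proof -
    obtain b where b: "b \<in> D (-1)" "a = nprod V Q 0 b" "a \<in> cycles"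
      using a by (auto simp: boundaries_def)
    obtain b' where b': "b' \<in> D (-1)" "a' = nprod V Q 0 b'" "a' \<in> cycles"
      using a by (auto simp: boundaries_def)
    show ?thesis
      using D_add[OF b(1) b'(1)] D_carrier[OF b(1)] D_carrier[OF b'(1)] cyc(5)[OF b(3) b'(3)] b b'
      by (intro boundariesI[of "b \<oplus> b'"]) (auto simp: nprod_add_right)
  qed
  have "\<zero> \<in> cycles" using D_zero by (simp add: cycles_def)
  then show "\<zero> \<in> boundaries" using D_zero by (intro boundariesI[of \<zero>]) auto
qed (use D_carrier in \<open>auto simp: boundaries_def cycles_def\<close>)

lemma boundaries_nprod_left:
  assumes b: "b \<in> boundaries" and a: "a \<in> cycles"
  shows "nprod V b m a \<in> boundaries"
proof -
  obtain c where c: "c \<in> D (-1)" "b = nprod V Q 0 c" "b \<in> cycles"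
    using b by (auto simp: boundaries_def)
  obtain c0 c1 where s: "c0 \<in> D (-1) \<inter> part V False" "c1 \<in> D (-1) \<inter> part V True" "c = c0 \<oplus> c1"
    using D_parts[OF c(1)] by blast
  have car: "c0 \<in> carrier V" "c1 \<in> carrier V" "a \<in> carrier V" "nprod V Q 0 a = \<zero>"
    using s a D_carrier part_carrier by (auto simp: cycles_def)
  have eq: "nprod V b m a = nprod V Q 0 (nprod V c m a)"
    using zero_mode_derivation[OF Q_odd, of c0 False a m]
      zero_mode_derivation[OF Q_odd, of c1 True a m] s car
    by (simp add: c(2) nprod_add_left nprod_add_right)
  have "nprod V c m a \<in> D (-1 + 0)" using c(1) a by (intro D_nprod) (auto simp: cycles_def)
  then show ?thesis using boundariesI[OF _ eq cycles_nprod[OF c(3) a]] by simp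
qed

text \<open>
  Moving the odd operator \<open>Q\<^sub>(\<^sub>0\<^sub>)\<close> past a cycle \<open>a\<close> twists \<open>a\<close> by the parity automorphism, so
  \<open>a\<^sub>(\<^sub>m\<^sub>)(Q\<^sub>(\<^sub>0\<^sub>)c)\<close> is the boundary of \<open>(a\<^sub>0 - a\<^sub>1)\<^sub>(\<^sub>m\<^sub>)c\<close> for the even and odd parts \<open>a\<^sub>0\<close>, \<open>a\<^sub>1\<close> of \<open>a\<close>.
\<close>

lemma boundaries_nprod_right:
  assumes a: "a \<in> cycles" and b: "b \<in> boundaries"
  shows "nprod V a m b \<in> boundaries"
proof -
  obtain c where c: "c \<in> D (-1)" "b = nprod V Q 0 c" "b \<in> cycles"
    using b by (auto simp: boundaries_def)
  obtain a0 a1 where s: "a0 \<in> cycles" "a0 \<in> part V False" "a1 \<in> cycles" "a1 \<in> part V True"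
    "a = a0 \<oplus> a1"
    using a by (rule cycles_parts)
  have car: "a0 \<in> carrier V" "a1 \<in> carrier V" "c \<in> carrier V"
    using s c D_carrier part_carrier by auto
  have "nprod V Q 0 (nprod V (a0 \<oplus> (-1) \<odot> a1) m c) = nprod V a m b"
    using zero_mode_derivation[OF Q_odd s(2) car(3), of m]
      zero_mode_derivation[OF Q_odd s(4) car(3), of m] s(1,3) car
    by (simp add: c(2) s(5) cycles_def ssign_def nprod_add_left nprod_add_right nprod_smult_left
        nprod_smult_right smult_smult)
  moreover have "nprod V (a0 \<oplus> (-1) \<odot> a1) m c \<in> D (0 + -1)"
    using s c by (intro D_nprod D_add D_smult) (auto simp: cycles_def)
  ultimately show ?thesis
    using cycles_nprod[OF a c(3), of m]
    by (intro boundariesI[of "nprod V (a0 \<oplus> (-1) \<odot> a1) m c"]) simp_all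
qed

sublocale vsa_subquotient V cycles boundaries
proof (intro vsa_subquotient.intro vsa_subquotient_axioms.intro)
  show "vertex_superalgebra V" by unfold_locales
  show "boundaries \<subseteq> cycles" by (auto simp: boundaries_def)
  show "vac V \<in> cycles" using D_vac by (simp add: cycles_def nprod_vac_nonneg)
  show "\<exists>a0 a1. a0 \<in> cycles \<inter> part V False \<and> a1 \<in> cycles \<inter> part V True \<and> a = a0 \<oplus> a1"
    if "a \<in> cycles" for a
    using that by (rule cycles_parts) blast
qed (use cycles_submodule boundaries_submodule cycles_nprod boundaries_nprod_left
      boundaries_nprod_right in auto)

end

section \<open>The BRST differential is odd\<close>

lemma kappaV_fnil_elem:
  assumes "podd n \<alpha>"
  shows "kappaV n (fnil n) (elem \<alpha>) = 0"
proof -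
  have "fnil n i c * elem \<alpha> c i = 0" for i c
  proof (rule ccontr)
    assume "fnil n i c * elem \<alpha> c i \<noteq> 0"
    then have f: "fnil n i c \<noteq> 0" and \<alpha>: "\<alpha> = (c, i)"
      by (auto simp: elem_def split: if_splits)
    obtain j where "j \<in> {1..n-1}" "elem (j + 1, j) i c \<noteq> 0"
      using f unfolding fnil_def by (meson sum.not_neutral_contains_not_neutral)
    then show False using assms \<alpha> by (auto simp: elem_def podd_def split: if_splits)
  qed
  then show ?thesis unfolding kappaV_def str_def mmult_def by (simp only: sum.neutral_const mult_zero_right)
qed

lemma sbracket_elem_parity:
  assumes "sbracket n (elem \<alpha>) (elem \<beta>) (fst \<gamma>) (snd \<gamma>) \<noteq> 0"
  shows "podd n \<gamma> \<longleftrightarrow> podd n \<alpha> \<noteq> podd n \<beta>"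
proof -
  obtain c where "elem \<alpha> (fst \<gamma>) c * elem \<beta> c (snd \<gamma>) -
      ssign (podd n (c, snd \<gamma>)) (podd n (fst \<gamma>, c)) * elem \<beta> (fst \<gamma>) c * elem \<alpha> c (snd \<gamma>) \<noteq> 0"
    using assms unfolding sbracket_def by (meson sum.not_neutral_contains_not_neutral)
  then have "(\<alpha> = (fst \<gamma>, c) \<and> \<beta> = (c, snd \<gamma>)) \<or> (\<beta> = (fst \<gamma>, c) \<and> \<alpha> = (c, snd \<gamma>))"
    by (auto simp: elem_def split: if_splits)
  then show ?thesis by (auto simp: podd_def)
qed

text \<open>
  The ghosts of \<open>e\<^sub>\<alpha>\<close> have parity opposite to \<open>e\<^sub>\<alpha>\<close>.  So \<open>e\<^sub>\<alpha>\<psi>\<^sup>*\<^sub>\<alpha>\<close> is odd, the constants \<open>(f|e\<^sub>\<alpha>)\<close> occur for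
  even \<open>e\<^sub>\<alpha>\<close> only, and the cubic terms have three ghosts, whose parities add up to an odd one when the
  structure constant is nonzero.
\<close>

lemma brst_odd_differential:
  assumes brst: "brst_complex n k C e g gs"
  shows "odd_differential C (brst_Q n C e g gs) (\<lambda>d. {a. brst_degree n C e g gs d a})"
proof -
  obtain A B where tensor: "is_tensor_product C A B"
    and aff: "universal_affine n k (restrict_vsa C A) e" and ghost: "ghost_vsa n (restrict_vsa C B) g gs"
    using brst by (auto simp: brst_complex_def)
  interpret vertex_superalgebra C using tensor by (simp add: is_tensor_product_def)
  have e: "e \<alpha> \<in> part C (podd n \<alpha>)" if "\<alpha> \<in> set (gl_indices n)" for \<alpha>
    using aff that by (auto simp: universal_affine_def)
  have gpl: "set (gplus n) \<subseteq> set (gl_indices n)" by (auto simp: gplus_def)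
  have g: "g \<alpha> \<in> part C (\<not> podd n \<alpha>)" and gs: "gs \<alpha> \<in> part C (\<not> podd n \<alpha>)"
    if "\<alpha> \<in> set (gplus n)" for \<alpha>
    using ghost that by (auto simp: ghost_vsa_def)
  note gen = e g gs
  have deg_carrier: "a \<in> carrier C" if "brst_degree n C e g gs d a" for d a
    using that by induction (auto intro: part_carrier[OF e] part_carrier[OF g] part_carrier[OF gs])
  have parts: "\<exists>a0 a1. a0 \<in> {a. brst_degree n C e g gs d a} \<inter> part C False \<and>
      a1 \<in> {a. brst_degree n C e g gs d a} \<inter> part C True \<and> a = a0 \<oplus>\<^bsub>C\<^esub> a1"
    (is "\<exists>a0 a1. ?P d a a0 a1") if "brst_degree n C e g gs d a" for d a
  proof -
    have homogeneous: "\<exists>a0 a1. ?P d a a0 a1" if "a \<in> part C p" "brst_degree n C e g gs d a" for p d a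
    proof (cases p)
      case True
      then show ?thesis
        using that part_carrier brst_degree.zero[of n C e g gs d]
        by (intro exI[of _ "\<zero>\<^bsub>C\<^esub>"] exI[of _ a]) auto
    next
      case False
      then show ?thesis
        using that part_carrier brst_degree.zero[of n C e g gs d]
        by (intro exI[of _ a] exI[of _ "\<zero>\<^bsub>C\<^esub>"]) auto
    qed
    show ?thesis using that
    proof induction
      case (zero d)
      show ?case using part_zero brst_degree.zero by (rule homogeneous)
    next
      case vac
      show ?case using vac_even brst_degree.vac by (rule homogeneous)
    next
      case (e \<alpha>)
      then show ?case by (intro homogeneous[OF gen(1)] brst_degree.e)
    next
      case (g \<alpha>)
      then show ?case by (intro homogeneous[OF gen(2)] brst_degree.g)
    next
      case (gs \<alpha>)
      then show ?case by (intro homogeneous[OF gen(3)] brst_degree.gs)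
    next
      case (add d a b)
      then obtain a0 a1 b0 b1 where a: "?P d a a0 a1" and b: "?P d b b0 b1" by blast
      have car: "a0 \<in> carrier C" "a1 \<in> carrier C" "b0 \<in> carrier C" "b1 \<in> carrier C"
        using a b part_carrier by auto
      show ?case
        using a b car by (intro exI[of _ "a0 \<oplus>\<^bsub>C\<^esub> b0"] exI[of _ "a1 \<oplus>\<^bsub>C\<^esub> b1"])
          (auto simp: part_add brst_degree.add M.a_ac)
    next
      case (smult d a s)
      then obtain a0 a1 where a: "?P d a a0 a1" by blast
      then show ?case
        using part_carrier by (intro exI[of _ "s \<odot>\<^bsub>C\<^esub> a0"] exI[of _ "s \<odot>\<^bsub>C\<^esub> a1"])
          (auto simp: part_smult brst_degree.smult smult_add_right)
    next
      case (nprod d a d' b m)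
      then obtain a0 a1 b0 b1 where a: "?P d a a0 a1" and b: "?P d' b b0 b1" by blast
      have car: "a0 \<in> carrier C" "a1 \<in> carrier C" "b0 \<in> carrier C" "b1 \<in> carrier C"
        using a b part_carrier by auto
      have "nprod C a0 m b0 \<in> part C False" "nprod C a1 m b1 \<in> part C False"
        "nprod C a0 m b1 \<in> part C True" "nprod C a1 m b0 \<in> part C True"
        using a b nprod_part[of a0 False b0 False m] nprod_part[of a1 True b1 True m]
          nprod_part[of a0 False b1 True m] nprod_part[of a1 True b0 False m] by auto
      then show ?case
        using a b car
        by (intro exI[of _ "nprod C a0 m b0 \<oplus>\<^bsub>C\<^esub> nprod C a1 m b1"]
            exI[of _ "nprod C a0 m b1 \<oplus>\<^bsub>C\<^esub> nprod C a1 m b0"])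
          (auto simp: part_add brst_degree.add brst_degree.nprod nprod_add_left nprod_add_right M.a_ac)
    qed
  qed
  have first: "(if podd n \<alpha> then -1 else 1) \<odot>\<^bsub>C\<^esub>
      nprod C (e \<alpha> \<oplus>\<^bsub>C\<^esub> kappaV n (fnil n) (elem \<alpha>) \<odot>\<^bsub>C\<^esub> vac C) (-1) (gs \<alpha>) \<in> part C True"
    if \<alpha>: "\<alpha> \<in> set (gplus n)" for \<alpha>
  proof -
    have ep: "e \<alpha> \<in> part C (podd n \<alpha>)" using e \<alpha> gpl by blast
    have "e \<alpha> \<oplus>\<^bsub>C\<^esub> kappaV n (fnil n) (elem \<alpha>) \<odot>\<^bsub>C\<^esub> vac C \<in> part C (podd n \<alpha>)"
    proof (cases "podd n \<alpha>")
      case True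
      then show ?thesis using kappaV_fnil_elem[OF True] ep part_carrier by simp
    next
      case False
      then show ?thesis using ep part_add part_smult vac_even by auto
    qed
    from nprod_part[OF this gs[OF \<alpha>], of "-1"] show ?thesis by (intro part_smult) simp
  qed
  have second: "(ssign (podd n \<alpha>) (podd n \<gamma>) * sbracket n (elem \<alpha>) (elem \<beta>) (fst \<gamma>) (snd \<gamma>)) \<odot>\<^bsub>C\<^esub>
        nprod C (g \<gamma>) (-1) (nprod C (gs \<alpha>) (-1) (gs \<beta>)) \<in> part C True"
    if "\<alpha> \<in> set (gplus n)" "\<beta> \<in> set (gplus n)" "\<gamma> \<in> set (gplus n)" for \<alpha> \<beta> \<gamma>
  proof (cases "sbracket n (elem \<alpha>) (elem \<beta>) (fst \<gamma>) (snd \<gamma>) = 0")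
    case True
    have "nprod C (g \<gamma>) (-1) (nprod C (gs \<alpha>) (-1) (gs \<beta>)) \<in> carrier C"
      using that by (intro nprod_closed part_carrier[OF g] part_carrier[OF gs])
    then show ?thesis using True by simp
  next
    case False
    have "nprod C (g \<gamma>) (-1) (nprod C (gs \<alpha>) (-1) (gs \<beta>)) \<in>
        part C ((\<not> podd n \<gamma>) \<noteq> ((\<not> podd n \<alpha>) \<noteq> (\<not> podd n \<beta>)))"
      using g gs that by (intro nprod_part) auto
    then have "nprod C (g \<gamma>) (-1) (nprod C (gs \<alpha>) (-1) (gs \<beta>)) \<in> part C True"
      using sbracket_elem_parity[OF False] by simp
    then show ?thesis by (rule part_smult)
  qed
  show ?thesis
  proof (intro odd_differential.intro odd_differential_axioms.intro)
    show "vertex_superalgebra C" by unfold_locales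
    show "brst_Q n C e g gs \<in> part C True"
      unfolding brst_Q_def
    proof (rule part_minus)
      show "(\<Oplus>\<^bsub>C\<^esub>\<alpha>\<in>set (gplus n). (if podd n \<alpha> then -1 else 1) \<odot>\<^bsub>C\<^esub>
          nprod C (e \<alpha> \<oplus>\<^bsub>C\<^esub> kappaV n (fnil n) (elem \<alpha>) \<odot>\<^bsub>C\<^esub> vac C) (-1) (gs \<alpha>)) \<in> part C True"
        by (intro part_finsum first)
    qed (use second in \<open>auto intro!: part_smult[where s = "1 / 2"] part_finsum\<close>)
    show "submodule {a. brst_degree n C e g gs d a} complex_ring C" for d
    proof (rule submoduleI)
      show "\<ominus>\<^bsub>C\<^esub> a \<in> {a. brst_degree n C e g gs d a}" if "a \<in> {a. brst_degree n C e g gs d a}" for a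
        using that deg_carrier brst_degree.smult[of n C e g gs d a "-1"] by (auto simp: smult_minus_1)
    qed (auto intro: brst_degree.intros deg_carrier)
  qed (use parts in \<open>auto intro: brst_degree.intros\<close>)
qed

section \<open>Coset and center\<close>

theorem theorem3p2:
  fixes n :: nat
    and C :: "complex \<Rightarrow> 'c vsa"
    and e g gs :: "complex \<Rightarrow> nat \<times> nat \<Rightarrow> 'c"
    and F :: "complex \<Rightarrow> 'f vsa"
    and psi psis :: "complex \<Rightarrow> 'f"
    and u :: "complex \<Rightarrow> nat \<Rightarrow> 'f"
    and \<Psi> :: "complex \<Rightarrow> 'c set \<Rightarrow> 'f"
    and kc :: complex and W :: "'c set vsa" and J :: "'c set"
  assumes "2 \<le> n"
    and "\<And>k. brst_complex n k (C k) (e k) (g k) (gs k)"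
    and "\<And>k. free_field_vsa n k (F k) (psi k) (psis k) (u k)"
    and "free_field_realization n C e g gs F psi psis u \<Psi>"
    and "kc = - dual_coxeter n"
    and "W = W_algebra n (C kc) (e kc) (g kc) (gs kc)"
    and "J \<in> carrier W"
    and "\<Psi> kc J = heis_current n (F kc) (psi kc) (psis kc) (u kc)"
  shows "heisenberg_coset W J = vcenter W"
proof -
  interpret C: odd_differential "C kc" "brst_Q n (C kc) (e kc) (g kc) (gs kc)"
    "\<lambda>d. {a. brst_degree n (C kc) (e kc) (g kc) (gs kc) d a}"
    by (rule brst_odd_differential[OF assms(2)])
  have W: "W = C.W"
    unfolding assms(6) W_algebra_def C.boundaries_def C.cycles_def coboundaries_def cocycles_def
    by simp
  interpret F: vertex_superalgebra "F kc"
    using assms(3)[of kc] by (auto simp: free_field_vsa_def is_tensor_product_def)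
  interpret E: vsa_embedded W "F kc" "\<Psi> kc"
  proof (intro vsa_embedded.intro vsa_embedded_axioms.intro)
    show "vsa_embedding W (F kc) (\<Psi> kc)"
      using assms(4) by (simp add: free_field_realization_def assms(6))
  qed (use C.W_abelian_group C.W_smult_closed C.W_nprod_closed C.W_parts F.vertex_superalgebra_axioms
      in \<open>auto simp: W C.W_carrier C.W_part\<close>)
  have J: "J \<in> vgen W {J}" by (rule vgen.incl) simp
  have vgen_closed: "b \<in> carrier W" if "b \<in> vgen W {J}" for b
    using that
    by induction (auto simp: W C.W_vac_closed assms(7)[unfolded W] C.W_smult_closed C.W_nprod_closed
        intro: abelian_groupE(1)[OF C.W_abelian_group])
  show ?thesis
  proof (intro equalityI subsetI)
    fix a assume "a \<in> vcenter W"
    then show "a \<in> heisenberg_coset W J"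
      using vgen_closed by (auto simp: vcenter_def heisenberg_coset_def commutant_def)
  next
    fix a assume "a \<in> heisenberg_coset W J"
    then have a: "a \<in> carrier W" and comm: "fields_commute W a J"
      using J by (auto simp: heisenberg_coset_def commutant_def)
    have vac: "vac W \<in> carrier W" using C.W_vac_closed by (simp add: W)
    have "mode_bracket (F kc) (\<Psi> kc a) m (heis_current n (F kc) (psi kc) (psis kc) (u kc)) l
        (vac (F kc)) = \<zero>\<^bsub>F kc\<^esub>" for m l
      using comm vac unfolding E.fields_commute_iff[OF a assms(7)] by (metis E.hom_vac assms(8))
    then have "\<Psi> kc a \<in> F.even_center"
      using critical_current_commutant[OF assms(3,5) E.hom(1)[OF a]] by blast
    then have "fields_commute (F kc) (\<Psi> kc a) (\<Psi> kc b)" if "b \<in> carrier W" for b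
      using F.even_center_fields_commute E.hom(1)[OF that] by blast
    then have "fields_commute W a b" if "b \<in> carrier W" for b
      unfolding E.fields_commute_iff[OF a that] using that E.hom(1)
      by (simp add: fields_commute_def)
    then show "a \<in> vcenter W" using a by (simp add: vcenter_def)
  qed
qed

end
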